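(* Let $\alpha=(A,(A_i)_{i\in I})$ be a coset incidence system, let $J,K\subseteq I$ and let $\varphi:A_J\to A_K$ be an admissible isomorphism. Suppose $A$ acts flag-transitively on $\alpha$. Then the HNN-extension $\alpha*_\varphi$ is flag-transitive, i.e. $A*_\varphi$ acts flag-transitively on $\alpha*_\varphi$. Additionally: (a) $\alpha*_\varphi$ is a geometry; (b) if $\alpha$ is also residually connected, then $\alpha*_\varphi$ is residually connected; (c) if $\alpha$ is also firm, then $\alpha*_\varphi$ is firm.
   Context: A coset incidence system $(G,(G_i)_{i\in I})$ consists of a group $G$ and a family of subgroups $G_i\le G$ indexed by a type set $I$. It denotes the incidence system whose elements of type $i$ are the left cosets $gG_i$, $g\in G$ (cosets of different types are regarded as different elements), two elements being incident iff their intersection is non-empty. Its rank is $|I|$. For $J\subseteq I$, $G_J=\bigcap_{j\in J}G_j$, with $G_\emptyset=G$; these are the parabolic subgroups. A flag is a set of pairwise incident elements; its type is the set of types of its elements; a chamber is a flag of type $I$; the corank of a flag $F$ is $|I|-|F|$. The system is a (coset) geometry if every maximal flag is a chamber. The residue of a flag $F$ is the incidence system of all elements incident to every element of $F$ and not in $F$; for a geometry it has rank $|I|-|F|$. A geometry is residually connected if every residue of rank at least two (including that of the empty flag) has connected incidence graph (so rank 1 geometries are residually connected). It is firm if every residue of a flag of corank one contains at least two elements. $G$ acts by left multiplication; $G$ is flag-transitive if for every $J\subseteq I$ it is transitive on the flags of type $J$. Admissible: an isomorphism $\varphi:C\to D$ between subgroups of $A$ is admissible if $C=A_J$ and $D=A_K$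 are parabolic subgroups of $\alpha$ and $\varphi$ induces an isomorphism between the lattice of parabolic subgroups of $\alpha$ contained in $C$ and the lattice of parabolic subgroups of $\alpha$ contained in $D$ (each parabolic subgroup contained in $C$ is sent to a unique parabolic subgroup contained in $D$, in a way preserving intersections). HNN-extension: $G=A*_\varphi=\langle A,t\mid t^{-1}at=\varphi(a)\ (a\in A_J)\rangle$. Let $\sim_\varphi$ be the equivalence relation on $I$ generated by: $i_1\sim_\varphi i_2$ whenever $i_1\in I\setminus J$, $i_2\in I\setminus K$ and $\varphi(A_{J\cup\{i_1\}})=A_{K\cup\{i_2\}}$. Let $\widetilde I$ be the set of equivalence classes (subsets of $I$). Then $\alpha*_\varphi=(G,(G_s)_{s\in\mathcal I})$ with type set $\mathcal I=\widetilde I\cup\{t\}$, where $G_s=\langle t,A_s\rangle$ with $A_s=\bigcap_{i\in s}A_i$ for $s\in\widetilde I$, and $G_t=A_F$ with $F=J\setminus K$.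
   Formalization: The type set I is assumed finite, and "admissible" means φ induces an isomorphism of the lattices of parabolic subgroups indexed by type sets (the same as the unindexed notion when distinct type sets give distinct parabolics); without either the claim fails. *)

theory Defs
  imports "HOL-Algebra.Coset" "HOL-Algebra.Generated_Groups"
begin

section \<open>Incidence systems\<close>

record ('i, 'x) incidence_system =
  typeset  :: "'i set"
  elements :: "'x set"
  type_of  :: "'x \<Rightarrow> 'i"
  incident :: "'x \<Rightarrow> 'x \<Rightarrow> bool"

definition flag :: "('i, 'x) incidence_system \<Rightarrow> 'x set \<Rightarrow> bool" where
  "flag S F \<longleftrightarrow> F \<subseteq> elements S \<and> (\<forall>x\<in>F. \<forall>y\<in>F. incident S x y)"

definition flag_type :: "('i, 'x) incidence_system \<Rightarrow> 'x set \<Rightarrow> 'i set" where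
  "flag_type S F = type_of S ` F"

definition chamber :: "('i, 'x) incidence_system \<Rightarrow> 'x set \<Rightarrow> bool" where
  "chamber S F \<longleftrightarrow> flag S F \<and> flag_type S F = typeset S"

definition maximal_flag :: "('i, 'x) incidence_system \<Rightarrow> 'x set \<Rightarrow> bool" where
  "maximal_flag S F \<longleftrightarrow> flag S F \<and> (\<forall>F'. flag S F' \<and> F \<subseteq> F' \<longrightarrow> F' = F)"

definition geometry :: "('i, 'x) incidence_system \<Rightarrow> bool" where
  "geometry S \<longleftrightarrow> (\<forall>F. maximal_flag S F \<longrightarrow> chamber S F)"

text \<open>Rank and corank are meant for finite type sets only.\<close>

definition rank :: "('i, 'x) incidence_system \<Rightarrow> nat" where
  "rank S = card (typeset S)"

definition corank :: "('i, 'x) incidence_system \<Rightarrow> 'x set \<Rightarrow> nat" where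
  "corank S F = rank S - card F"

text \<open>The residue of \<open>F\<close> has type set \<open>typeset S - flag_type S F\<close>, so that its rank is the
  corank of \<open>F\<close> whenever distinct elements of a flag have distinct types, as is the case for
  cosets.\<close>

definition residue :: "('i, 'x) incidence_system \<Rightarrow> 'x set \<Rightarrow> ('i, 'x) incidence_system" where
  "residue S F =
     \<lparr>typeset = typeset S - flag_type S F,
      elements = {x \<in> elements S. x \<notin> F \<and> (\<forall>y\<in>F. incident S x y)},
      type_of = type_of S,
      incident = incident S\<rparr>"

definition connected_incidence_graph :: "('i, 'x) incidence_system \<Rightarrow> bool" where
  "connected_incidence_graph S \<longleftrightarrow>
     (\<forall>x\<in>elements S. \<forall>y\<in>elements S.
        (x, y) \<in> {(u, v). u \<in> elements S \<and> v \<in> elements S \<and> incident S u v}\<^sup>*)"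

definition residually_connected :: "('i, 'x) incidence_system \<Rightarrow> bool" where
  "residually_connected S \<longleftrightarrow> geometry S \<and>
     (\<forall>F. flag S F \<and> rank (residue S F) \<ge> 2 \<longrightarrow> connected_incidence_graph (residue S F))"

definition firm :: "('i, 'x) incidence_system \<Rightarrow> bool" where
  "firm S \<longleftrightarrow> geometry S \<and>
     (\<forall>F. flag S F \<and> corank S F = 1 \<longrightarrow>
        (\<exists>x\<in>elements (residue S F). \<exists>y\<in>elements (residue S F). x \<noteq> y))"


section \<open>Coset incidence systems\<close>

text \<open>A family of subgroups of \<open>G\<close> is a function \<open>H\<close> together with a type set \<open>I\<close>; the values of
  \<open>H\<close> outside \<open>I\<close> are irrelevant.  The subgroups \<open>H i\<close> need not be distinct.\<close>

definition coset_incidence_data ::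
    "('a, 'b) monoid_scheme \<Rightarrow> 'i set \<Rightarrow> ('i \<Rightarrow> 'a set) \<Rightarrow> bool" where
  "coset_incidence_data G I H \<longleftrightarrow> group G \<and> (\<forall>i\<in>I. subgroup (H i) G)"

text \<open>An element is a coset tagged with its type, so cosets of different types are different.\<close>

definition coset_system ::
    "('a, 'b) monoid_scheme \<Rightarrow> 'i set \<Rightarrow> ('i \<Rightarrow> 'a set) \<Rightarrow> ('i, 'i \<times> 'a set) incidence_system" where
  "coset_system G I H =
     \<lparr>typeset = I,
      elements = {(i, g <#\<^bsub>G\<^esub> H i) | i g. i \<in> I \<and> g \<in> carrier G},
      type_of = fst,
      incident = (\<lambda>x y. snd x \<inter> snd y \<noteq> {})\<rparr>"

definition left_translate :: "('a, 'b) monoid_scheme \<Rightarrow> 'a \<Rightarrow> 'i \<times> 'a set \<Rightarrow> 'i \<times> 'a set" where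
  "left_translate G g x = (fst x, g <#\<^bsub>G\<^esub> snd x)"

definition flag_transitive ::
    "('a, 'b) monoid_scheme \<Rightarrow> 'i set \<Rightarrow> ('i \<Rightarrow> 'a set) \<Rightarrow> bool" where
  "flag_transitive G I H \<longleftrightarrow>
     (\<forall>L\<subseteq>I. \<forall>F F'.
        flag (coset_system G I H) F \<and> flag_type (coset_system G I H) F = L \<and>
        flag (coset_system G I H) F' \<and> flag_type (coset_system G I H) F' = L \<longrightarrow>
        (\<exists>g\<in>carrier G. left_translate G g ` F = F'))"

definition parabolic ::
    "('a, 'b) monoid_scheme \<Rightarrow> ('i \<Rightarrow> 'a set) \<Rightarrow> 'i set \<Rightarrow> 'a set" where
  "parabolic G H L = carrier G \<inter> (\<Inter>i\<in>L. H i)"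

text \<open>The parabolic subgroups contained in \<open>A\<^sub>J\<close> are the \<open>A\<^sub>L\<close> with \<open>J \<subseteq> L \<subseteq> I\<close>.  They are regarded
  as a lattice indexed by the type sets \<open>L\<close>, in which the intersection of \<open>A\<^sub>L\<close> and \<open>A\<^sub>M\<close> is
  \<open>A\<^bsub>L \<union> M\<^esub>\<close>; \<open>\<psi>\<close> below is the isomorphism of these lattices induced by \<open>\<phi>\<close>.  When different type
  sets give different subgroups, this says that \<open>\<phi>\<close> maps the set of parabolic subgroups contained
  in \<open>A\<^sub>J\<close> bijectively onto the set of those contained in \<open>A\<^sub>K\<close>: see
  \<open>admissible_iff_bij_betw_subgroups\<close>.  Without such injectivity the indexing matters: a map of
  sets of subgroups may send some \<open>A\<^bsub>J \<union> {i}\<^esub>\<close> to an intersection that is not of the form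
  \<open>A\<^bsub>K \<union> {i'}\<^esub>\<close>, and then \<open>\<sim>\<close> below does not see the type \<open>i\<close>.\<close>

definition admissible ::
    "('a, 'b) monoid_scheme \<Rightarrow> 'i set \<Rightarrow> ('i \<Rightarrow> 'a set) \<Rightarrow> 'i set \<Rightarrow> 'i set \<Rightarrow> ('a \<Rightarrow> 'a) \<Rightarrow> bool" where
  "admissible A I H J K \<phi> \<longleftrightarrow>
     \<phi> \<in> iso (A\<lparr>carrier := parabolic A H J\<rparr>) (A\<lparr>carrier := parabolic A H K\<rparr>) \<and>
     (\<exists>\<psi>. bij_betw \<psi> {L. J \<subseteq> L \<and> L \<subseteq> I} {M. K \<subseteq> M \<and> M \<subseteq> I} \<and>
          (\<forall>L M. J \<subseteq> L \<and> L \<subseteq> I \<and> J \<subseteq> M \<and> M \<subseteq> I \<longrightarrow> \<psi> (L \<union> M) = \<psi> L \<union> \<psi> M) \<and>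
          (\<forall>L. J \<subseteq> L \<and> L \<subseteq> I \<longrightarrow> \<phi> ` parabolic A H L = parabolic A H (\<psi> L)))"

lemma parabolics_below:
  assumes "J \<subseteq> I"
  shows "{P. \<exists>L\<subseteq>I. P = parabolic A H L \<and> P \<subseteq> parabolic A H J} =
         parabolic A H ` {L. J \<subseteq> L \<and> L \<subseteq> I}"
    (is "?below = _")
proof (intro equalityI subsetI)
  fix P assume "P \<in> ?below"
  then obtain L where "L \<subseteq> I" "P = parabolic A H L" "P \<subseteq> parabolic A H J" by auto
  then show "P \<in> parabolic A H ` {L. J \<subseteq> L \<and> L \<subseteq> I}"
    using assms by (intro image_eqI[of _ _ "J \<union> L"]) (auto simp: parabolic_def)
next
  fix P assume "P \<in> parabolic A H ` {L. J \<subseteq> L \<and> L \<subseteq> I}"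
  then obtain L where L: "J \<subseteq> L" "L \<subseteq> I" "P = parabolic A H L" by auto
  moreover have "P \<subseteq> parabolic A H J" using L by (auto simp: parabolic_def)
  ultimately show "P \<in> ?below" by auto
qed

lemma admissible_iff_bij_betw_subgroups:
  assumes JK: "J \<subseteq> I" "K \<subseteq> I" and inj: "inj_on (parabolic A H) (Pow I)"
  shows "admissible A I H J K \<phi> \<longleftrightarrow>
     \<phi> \<in> iso (A\<lparr>carrier := parabolic A H J\<rparr>) (A\<lparr>carrier := parabolic A H K\<rparr>) \<and>
     bij_betw ((`) \<phi>)
       {P. \<exists>L\<subseteq>I. P = parabolic A H L \<and> P \<subseteq> parabolic A H J}
       {P. \<exists>L\<subseteq>I. P = parabolic A H L \<and> P \<subseteq> parabolic A H K}"
    (is "?adm \<longleftrightarrow> ?iso \<and> ?bij")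
proof -
  let ?P = "parabolic A H"
  let ?J = "{L. J \<subseteq> L \<and> L \<subseteq> I}" and ?K = "{L. K \<subseteq> L \<and> L \<subseteq> I}"
  have bJ: "bij_betw ?P ?J (?P ` ?J)" and bK: "bij_betw ?P ?K (?P ` ?K)"
    by (auto intro!: inj_on_imp_bij_betw inj_on_subset[OF inj])
  have Un: "?P (L \<union> M) = ?P L \<inter> ?P M" for L M by (auto simp: parabolic_def)
  have sub: "?P L \<subseteq> ?P J" if "J \<subseteq> L" for L using that by (auto simp: parabolic_def)
  show ?thesis
  proof (intro iffI conjI)
    assume adm: ?adm
    then show ?iso by (simp add: admissible_def)
    obtain \<psi> where \<psi>: "bij_betw \<psi> ?J ?K" "\<forall>L. J \<subseteq> L \<and> L \<subseteq> I \<longrightarrow> \<phi> ` ?P L = ?P (\<psi> L)"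
      using adm unfolding admissible_def by (elim conjE exE) (rule that)
    have "bij_betw (?P \<circ> \<psi>) ?J (?P ` ?K)" by (rule bij_betw_trans[OF \<psi>(1) bK])
    then have "bij_betw ((`) \<phi> \<circ> ?P) ?J (?P ` ?K)"
      by (rule bij_betw_cong[THEN iffD1, rotated]) (use \<psi>(2) in auto)
    then have "bij_betw ((`) \<phi>) (?P ` ?J) (?P ` ?K)"
      by (simp add: bij_betw_comp_iff[OF bJ])
    then show ?bij using JK by (simp add: parabolics_below)
  next
    assume *: "?iso \<and> ?bij"
    then have b: "bij_betw ((`) \<phi>) (?P ` ?J) (?P ` ?K)" using JK by (simp add: parabolics_below)
    have inj\<phi>: "inj_on \<phi> (?P J)" using * by (auto simp: iso_def bij_betw_def)
    let ?\<psi> = "the_inv_into ?K ?P \<circ> ((`) \<phi> \<circ> ?P)"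
    have b1: "bij_betw ((`) \<phi> \<circ> ?P) ?J (?P ` ?K)" by (rule bij_betw_trans[OF bJ b])
    have b2: "bij_betw ?\<psi> ?J ?K"
      by (rule bij_betw_trans[OF b1 bij_betw_the_inv_into[OF bK]])
    have im: "?P (?\<psi> L) = \<phi> ` ?P L" if "L \<in> ?J" for L
      using f_the_inv_into_f[of ?P ?K "\<phi> ` ?P L"] bK bij_betwE[OF b1] that
      by (auto simp: bij_betw_def)
    have "?\<psi> (L \<union> M) = ?\<psi> L \<union> ?\<psi> M" if L: "L \<in> ?J" and M: "M \<in> ?J" for L M
    proof -
      have LM: "L \<union> M \<in> ?J" using L M by auto
      have "?P (?\<psi> (L \<union> M)) = \<phi> ` (?P L \<inter> ?P M)" unfolding im[OF LM] Un ..
      also have "\<dots> = \<phi> ` ?P L \<inter> \<phi> ` ?P M"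
        by (rule inj_on_image_Int[OF inj\<phi>]) (use L M sub in auto)
      also have "\<dots> = ?P (?\<psi> L \<union> ?\<psi> M)" unfolding Un im[OF L] im[OF M] ..
      finally have eq: "?P (?\<psi> (L \<union> M)) = ?P (?\<psi> L \<union> ?\<psi> M)" .
      have "?\<psi> (L \<union> M) \<in> Pow I" "?\<psi> L \<union> ?\<psi> M \<in> Pow I"
        using bij_betwE[OF b2] L M LM by auto
      then show ?thesis using inj_onD[OF inj eq] by simp
    qed
    then show ?adm
      unfolding admissible_def using * b2 im by (intro conjI exI[of _ ?\<psi>]) auto
  qed
qed


section \<open>HNN-extensions\<close>

text \<open>The group \<open>\<langle>A, t | t\<inverse> a t = \<phi> a (a \<in> C)\<rangle>\<close>: words in the elements of \<open>A\<close> and in \<open>t\<close>, \<open>t\<inverse>\<close>,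
  modulo the congruence generated by the multiplication of \<open>A\<close>, by \<open>t t\<inverse> = t\<inverse> t = 1\<close> and by the
  relations displayed.\<close>

datatype 'a hnn_letter = Base 'a | Stable | StableInv

definition hnn_words :: "('a, 'b) monoid_scheme \<Rightarrow> 'a hnn_letter list set" where
  "hnn_words A = lists (Base ` carrier A \<union> {Stable, StableInv})"

inductive_set hnn_cong ::
    "('a, 'b) monoid_scheme \<Rightarrow> 'a set \<Rightarrow> ('a \<Rightarrow> 'a) \<Rightarrow> ('a hnn_letter list \<times> 'a hnn_letter list) set"
  for A (structure) and C \<phi> where
  refl: "w \<in> hnn_words A \<Longrightarrow> (w, w) \<in> hnn_cong A C \<phi>"
| sym: "(v, w) \<in> hnn_cong A C \<phi> \<Longrightarrow> (w, v) \<in> hnn_cong A C \<phi>"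
| trans: "(u, v) \<in> hnn_cong A C \<phi> \<Longrightarrow> (v, w) \<in> hnn_cong A C \<phi> \<Longrightarrow> (u, w) \<in> hnn_cong A C \<phi>"
| append: "(v, v') \<in> hnn_cong A C \<phi> \<Longrightarrow> (w, w') \<in> hnn_cong A C \<phi> \<Longrightarrow>
    (v @ w, v' @ w') \<in> hnn_cong A C \<phi>"
| base_mult: "a \<in> carrier A \<Longrightarrow> b \<in> carrier A \<Longrightarrow> ([Base a, Base b], [Base (a \<otimes> b)]) \<in> hnn_cong A C \<phi>"
| base_one: "([Base \<one>], []) \<in> hnn_cong A C \<phi>"
| stable_inv: "([Stable, StableInv], []) \<in> hnn_cong A C \<phi>"
| inv_stable: "([StableInv, Stable], []) \<in> hnn_cong A C \<phi>"
| conjugate: "a \<in> C \<Longrightarrow> ([StableInv, Base a, Stable], [Base (\<phi> a)]) \<in> hnn_cong A C \<phi>"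

definition hnn_extension ::
    "('a, 'b) monoid_scheme \<Rightarrow> 'a set \<Rightarrow> ('a \<Rightarrow> 'a) \<Rightarrow> 'a hnn_letter list set monoid" where
  "hnn_extension A C \<phi> =
     \<lparr>carrier = hnn_words A // hnn_cong A C \<phi>,
      mult = (\<lambda>X Y. \<Union>x\<in>X. \<Union>y\<in>Y. hnn_cong A C \<phi> `` {x @ y}),
      one = hnn_cong A C \<phi> `` {[]}\<rparr>"

definition hnn_base ::
    "('a, 'b) monoid_scheme \<Rightarrow> 'a set \<Rightarrow> ('a \<Rightarrow> 'a) \<Rightarrow> 'a \<Rightarrow> 'a hnn_letter list set" where
  "hnn_base A C \<phi> a = hnn_cong A C \<phi> `` {[Base a]}"

definition hnn_stable ::
    "('a, 'b) monoid_scheme \<Rightarrow> 'a set \<Rightarrow> ('a \<Rightarrow> 'a) \<Rightarrow> 'a hnn_letter list set" where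
  "hnn_stable A C \<phi> = hnn_cong A C \<phi> `` {[Stable]}"

lemma hnn_cong_words:
  assumes "group A" "C \<subseteq> carrier A" "\<phi> ` C \<subseteq> carrier A" "(v, w) \<in> hnn_cong A C \<phi>"
  shows "v \<in> hnn_words A \<and> w \<in> hnn_words A"
proof -
  interpret group A by fact
  show ?thesis
    using assms(4)
  proof induction
    case (conjugate a)
    then show ?case using assms(2,3) by (auto simp: hnn_words_def)
  qed (auto simp: hnn_words_def)
qed

lemma equiv_hnn_cong:
  assumes "group A" "C \<subseteq> carrier A" "\<phi> ` C \<subseteq> carrier A"
  shows "equiv (hnn_words A) (hnn_cong A C \<phi>)"
  using hnn_cong_words[OF assms]
  by (intro equivI refl_onI symI transI)
     (auto intro: hnn_cong.refl hnn_cong.sym hnn_cong.trans)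

lemma hnn_mult_class:
  assumes "group A" "C \<subseteq> carrier A" "\<phi> ` C \<subseteq> carrier A"
    and "v \<in> hnn_words A" "w \<in> hnn_words A"
  shows "hnn_cong A C \<phi> `` {v} \<otimes>\<^bsub>hnn_extension A C \<phi>\<^esub> hnn_cong A C \<phi> `` {w} =
         hnn_cong A C \<phi> `` {v @ w}"
proof -
  have "congruent2 (hnn_cong A C \<phi>) (hnn_cong A C \<phi>) (\<lambda>x y. hnn_cong A C \<phi> `` {x @ y})"
    unfolding congruent2_def
    by (auto intro!: equiv_class_eq[OF equiv_hnn_cong[OF assms(1-3)]] hnn_cong.append)
  from UN_equiv_class2[OF equiv_hnn_cong[OF assms(1-3)] equiv_hnn_cong[OF assms(1-3)] this assms(4,5)]
  show ?thesis by (simp add: hnn_extension_def)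
qed

lemma group_hnn_extension:
  assumes "group A" "C \<subseteq> carrier A" "\<phi> ` C \<subseteq> carrier A"
  shows "group (hnn_extension A C \<phi>)"
proof -
  interpret group A by fact
  let ?R = "hnn_cong A C \<phi>" and ?W = "hnn_words A"
  note eq = equiv_hnn_cong[OF assms] and mult = hnn_mult_class[OF assms]
  have nil: "[] \<in> ?W" and app: "v \<in> ?W \<Longrightarrow> w \<in> ?W \<Longrightarrow> v @ w \<in> ?W" for v w
    by (auto simp: hnn_words_def)
  have car: "carrier (hnn_extension A C \<phi>) = ?W // ?R"
    and one: "\<one>\<^bsub>hnn_extension A C \<phi>\<^esub> = ?R `` {[]}"
    by (simp_all add: hnn_extension_def)
  have linv: "\<exists>v\<in>?W. (v @ w, []) \<in> ?R" if "w \<in> ?W" for w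
    using that
  proof (induction w)
    case Nil
    then show ?case using nil by (auto intro: hnn_cong.refl)
  next
    case (Cons x w)
    then have w: "w \<in> ?W" by (auto simp: hnn_words_def)
    with Cons obtain v where v: "v \<in> ?W" "(v @ w, []) \<in> ?R" by auto
    obtain y where y: "[y] \<in> ?W" "([y, x], []) \<in> ?R"
    proof (cases x)
      case (Base a)
      then have a: "a \<in> carrier A" using Cons.prems by (auto simp: hnn_words_def)
      have "([Base (inv\<^bsub>A\<^esub> a), Base a], [Base \<one>\<^bsub>A\<^esub>]) \<in> ?R"
        using hnn_cong.base_mult[of "inv\<^bsub>A\<^esub> a" A a] a by simp
      then have "([Base (inv\<^bsub>A\<^esub> a), Base a], []) \<in> ?R"
        by (rule hnn_cong.trans[OF _ hnn_cong.base_one])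
      then show thesis using that[of "Base (inv\<^bsub>A\<^esub> a)"] a Base by (auto simp: hnn_words_def)
    next
      case Stable
      then show thesis using that[of StableInv] by (auto simp: hnn_words_def intro: hnn_cong.intros)
    next
      case StableInv
      then show thesis using that[of Stable] by (auto simp: hnn_words_def intro: hnn_cong.intros)
    qed
    have "(v @ [y, x] @ w, v @ [] @ w) \<in> ?R"
      by (intro hnn_cong.append y hnn_cong.refl v w)
    then have "((v @ [y]) @ x # w, []) \<in> ?R" using v(2) by (auto intro: hnn_cong.trans)
    then show ?case using app[OF v(1) y(1)] by blast
  qed
  show ?thesis
  proof (rule groupI; unfold car one)
    show "?R `` {[]} \<in> ?W // ?R" using nil by (rule quotientI)
    fix X Y assume X: "X \<in> ?W // ?R" and Y: "Y \<in> ?W // ?R"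
    show "X \<otimes>\<^bsub>hnn_extension A C \<phi>\<^esub> Y \<in> ?W // ?R"
      using X Y by (auto elim!: quotientE simp: mult app intro!: quotientI)
    show "(X \<otimes>\<^bsub>hnn_extension A C \<phi>\<^esub> Y) \<otimes>\<^bsub>hnn_extension A C \<phi>\<^esub> Z =
        X \<otimes>\<^bsub>hnn_extension A C \<phi>\<^esub> (Y \<otimes>\<^bsub>hnn_extension A C \<phi>\<^esub> Z)" if "Z \<in> ?W // ?R" for Z
      using X Y that by (auto elim!: quotientE simp: mult app)
    show "?R `` {[]} \<otimes>\<^bsub>hnn_extension A C \<phi>\<^esub> X = X"
      using X by (auto elim!: quotientE simp: mult nil)
    show "\<exists>Y\<in>?W // ?R. Y \<otimes>\<^bsub>hnn_extension A C \<phi>\<^esub> X = ?R `` {[]}"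
    proof -
      obtain w where w: "w \<in> ?W" "X = ?R `` {w}" using X by (auto elim: quotientE)
      obtain v where v: "v \<in> ?W" "(v @ w, []) \<in> ?R" using linv[OF w(1)] by blast
      have "?R `` {v} \<otimes>\<^bsub>hnn_extension A C \<phi>\<^esub> X = ?R `` {[]}"
        unfolding w(2) mult[OF v(1) w(1)] by (rule equiv_class_eq[OF eq v(2)])
      then show ?thesis using quotientI[OF v(1)] by blast
    qed
  qed
qed


section \<open>The HNN-extension of a coset incidence system\<close>

text \<open>The equivalence relation on \<open>I\<close> generated by \<open>i\<^sub>1 \<sim> i\<^sub>2\<close> whenever \<open>i\<^sub>1 \<in> I - J\<close>, \<open>i\<^sub>2 \<in> I - K\<close> and
  \<open>\<phi>\<close> maps \<open>A\<^bsub>J \<union> {i\<^sub>1}\<^esub>\<close> onto \<open>A\<^bsub>K \<union> {i\<^sub>2}\<^esub>\<close>.\<close>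

definition hnn_type_equiv ::
    "('a, 'b) monoid_scheme \<Rightarrow> 'i set \<Rightarrow> ('i \<Rightarrow> 'a set) \<Rightarrow> 'i set \<Rightarrow> 'i set \<Rightarrow> ('a \<Rightarrow> 'a) \<Rightarrow> ('i \<times> 'i) set" where
  "hnn_type_equiv A I H J K \<phi> =
     (let r = {(i\<^sub>1, i\<^sub>2). i\<^sub>1 \<in> I - J \<and> i\<^sub>2 \<in> I - K \<and>
                 \<phi> ` parabolic A H (J \<union> {i\<^sub>1}) = parabolic A H (K \<union> {i\<^sub>2})}
      in (r \<union> r\<inverse>)\<^sup>* \<inter> I \<times> I)"

text \<open>\<open>None\<close> is the additional type \<open>t\<close>.\<close>

definition hnn_types ::
    "('a, 'b) monoid_scheme \<Rightarrow> 'i set \<Rightarrow> ('i \<Rightarrow> 'a set) \<Rightarrow> 'i set \<Rightarrow> 'i set \<Rightarrow> ('a \<Rightarrow> 'a) \<Rightarrow>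
     'i set option set" where
  "hnn_types A I H J K \<phi> = insert None (Some ` (I // hnn_type_equiv A I H J K \<phi>))"

abbreviation hnn_group ::
    "('a, 'b) monoid_scheme \<Rightarrow> ('i \<Rightarrow> 'a set) \<Rightarrow> 'i set \<Rightarrow> ('a \<Rightarrow> 'a) \<Rightarrow>
     'a hnn_letter list set monoid" where
  "hnn_group A H J \<phi> \<equiv> hnn_extension A (parabolic A H J) \<phi>"

definition hnn_subgroup ::
    "('a, 'b) monoid_scheme \<Rightarrow> ('i \<Rightarrow> 'a set) \<Rightarrow> 'i set \<Rightarrow> 'i set \<Rightarrow> ('a \<Rightarrow> 'a) \<Rightarrow>
     'i set option \<Rightarrow> 'a hnn_letter list set set" where
  "hnn_subgroup A H J K \<phi> s =
     (case s of
        None \<Rightarrow> hnn_base A (parabolic A H J) \<phi> ` parabolic A H (J - K)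
      | Some s \<Rightarrow> generate (hnn_group A H J \<phi>)
                   (insert (hnn_stable A (parabolic A H J) \<phi>)
                      (hnn_base A (parabolic A H J) \<phi> ` parabolic A H s)))"

end

theory Submission
  imports Defs "HOL-Library.Sublist"
begin

text \<open>A coset system is flag-transitive iff it has the Helly property: pairwise intersecting cosets
  of the subgroups of the family have a common element.  Let \<open>G\<close> be the HNN-extension.  The coset
  \<open>g\<langle>t, A\<^sub>s\<rangle>\<close> spans a subtree of the Bass-Serre tree of \<open>G\<close>, the coset \<open>gA\<^sub>F\<close> a single vertex.
  Pairwise intersecting subtrees have a common vertex, which we may take to be \<open>A\<close>.  If two such
  cosets intersect and their subtrees contain the vertex \<open>A\<close>, then they intersect inside \<open>A\<close>: a
  common element is moved to an adjacent vertex by the Helly property of \<open>\<alpha>\<close>, applied to two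
  parabolic cosets and a coset of \<open>A\<^sub>J\<close> or \<open>A\<^sub>K\<close>.  So the Helly property of \<open>\<alpha>\<close> yields that
  of the HNN-extension.  The same argument gives \<open>\<langle>t, A\<^sub>X\<rangle> \<inter> \<langle>t, A\<^sub>Y\<rangle> = \<langle>t, A\<^bsub>X \<union> Y\<^esub>\<rangle>\<close> for
  unions \<open>X\<close>, \<open>Y\<close> of classes.

  Residual connectedness means that each parabolic subgroup of corank at least two is generated by
  those just below it.  For \<open>\<alpha>\<close> this implies \<open>\<langle>A\<^sub>X, A\<^sub>Y\<rangle> = A\<^bsub>X \<inter> Y\<^esub>\<close>; conjugation by \<open>t\<close> turns
  \<open>A\<^bsub>U \<union> F\<^esub> \<supseteq> A\<^bsub>U \<union> J\<^esub>\<close> into \<open>A\<^bsub>U \<union> K\<^esub>\<close>, and \<open>(U \<union> F) \<inter> (U \<union> K) = U\<close>.  Firmness follows from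
  \<open>t \<notin> A\<close> and from the fact that no class is contained in \<open>F\<close>.\<close>

section \<open>Coset systems with the Helly property\<close>

lemma (in group) mem_l_coset_iff:
  assumes "subgroup H G" "a \<in> carrier G"
  shows "x \<in> a <# H \<longleftrightarrow> x \<in> carrier G \<and> inv a \<otimes> x \<in> H"
proof -
  have "x \<in> a <# H" if "x \<in> carrier G" "inv a \<otimes> x \<in> H"
    using that assms unfolding l_coset_def by (force simp: m_assoc[symmetric])
  moreover have "x \<in> carrier G \<and> inv a \<otimes> x \<in> H" if "x \<in> a <# H"
    using that assms subgroup.mem_carrier[OF assms(1)]
    unfolding l_coset_def by (auto simp: m_assoc[symmetric])
  ultimately show ?thesis by blast
qed

text \<open>A coset is given by a type and a representative, so \<open>P\<close> may list one coset
  under several representatives. Two cosets of the same type in \<open>P\<close> meet and hence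
  coincide.\<close>

definition helly ::
    "('a, 'b) monoid_scheme \<Rightarrow> 'i set \<Rightarrow> ('i \<Rightarrow> 'a set) \<Rightarrow> bool" where
  "helly G I H \<longleftrightarrow>
     (\<forall>P \<subseteq> I \<times> carrier G.
        (\<forall>(i, g)\<in>P. \<forall>(j, h)\<in>P. (g <#\<^bsub>G\<^esub> H i) \<inter> (h <#\<^bsub>G\<^esub> H j) \<noteq> {}) \<longrightarrow>
        (\<exists>x\<in>carrier G. \<forall>(i, g)\<in>P. x \<in> g <#\<^bsub>G\<^esub> H i))"

locale coset_data = group G for G :: "('a, 'b) monoid_scheme" (structure) +
  fixes I :: "'i set" and H :: "'i \<Rightarrow> 'a set"
  assumes H_subgroup: "i \<in> I \<Longrightarrow> subgroup (H i) G"
begin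

abbreviation S where "S \<equiv> coset_system G I H"
abbreviation par where "par L \<equiv> parabolic G H L"

lemma S_simps [simp]:
  "typeset S = I" "elements S = {(i, g <# H i) | i g. i \<in> I \<and> g \<in> carrier G}"
  "type_of S = fst" "incident S x y \<longleftrightarrow> snd x \<inter> snd y \<noteq> {}"
  by (simp_all add: coset_system_def)

lemma par_subgroup:
  assumes "L \<subseteq> I" shows "subgroup (par L) G"
proof
  show "x \<otimes> y \<in> par L" if "x \<in> par L" "y \<in> par L" for x y
    using that assms by (auto simp: parabolic_def intro!: subgroup.m_closed[OF H_subgroup])
  show "inv x \<in> par L" if "x \<in> par L" for x
    using that assms by (auto simp: parabolic_def intro!: subgroup.m_inv_closed[OF H_subgroup])
  show "\<one> \<in> par L"
    using assms by (auto simp: parabolic_def intro!: subgroup.one_closed[OF H_subgroup])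
qed (auto simp: parabolic_def)

lemma l_coset_self: "i \<in> I \<Longrightarrow> g \<in> carrier G \<Longrightarrow> g \<in> g <# H i"
  by (simp add: mem_l_coset_iff[OF H_subgroup] subgroup.one_closed[OF H_subgroup])

lemma l_coset_eq:
  assumes "i \<in> I" "g \<in> carrier G" "x \<in> g <# H i" shows "x <# H i = g <# H i"
  using l_repr_independence[OF assms(3,2) H_subgroup[OF assms(1)]] by simp

lemma hellyD:
  assumes "helly G I H" "P \<subseteq> I \<times> carrier G"
    and "\<And>i g j h. (i, g) \<in> P \<Longrightarrow> (j, h) \<in> P \<Longrightarrow> (g <# H i) \<inter> (h <# H j) \<noteq> {}"
  obtains x where "x \<in> carrier G" "\<And>i g. (i, g) \<in> P \<Longrightarrow> x \<in> g <# H i"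
proof -
  have "\<forall>(i, g)\<in>P. \<forall>(j, h)\<in>P. (g <# H i) \<inter> (h <# H j) \<noteq> {}" using assms(3) by blast
  then have "\<exists>x\<in>carrier G. \<forall>(i, g)\<in>P. x \<in> g <# H i"
    by (rule assms(1)[unfolded helly_def, THEN spec, THEN mp, THEN mp, OF assms(2)])
  then show ?thesis using that by blast
qed

text \<open>Cosets of one subgroup that meet are equal, so families with a single representative for
  each type suffice.\<close>

lemma hellyI:
  assumes "\<And>L g. L \<subseteq> I \<Longrightarrow> g \<in> L \<rightarrow> carrier G \<Longrightarrow>
      (\<And>i j. i \<in> L \<Longrightarrow> j \<in> L \<Longrightarrow> (g i <# H i) \<inter> (g j <# H j) \<noteq> {}) \<Longrightarrow>
      \<exists>x\<in>carrier G. \<forall>i\<in>L. x \<in> g i <# H i"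
  shows "helly G I H"
  unfolding helly_def
proof (intro allI impI)
  fix P assume P: "P \<subseteq> I \<times> carrier G"
    and meet: "\<forall>(i, g)\<in>P. \<forall>(j, h)\<in>P. (g <# H i) \<inter> (h <# H j) \<noteq> {}"
  define g where "g i = (SOME g. (i, g) \<in> P)" for i
  have g: "(i, g i) \<in> P" if i: "i \<in> fst ` P" for i
  proof -
    obtain h where "(i, h) \<in> P" using i by force
    then show ?thesis unfolding g_def by (rule someI)
  qed
  have meet': "(g <# H i) \<inter> (h <# H j) \<noteq> {}" if "(i, g) \<in> P" "(j, h) \<in> P" for i g j h
    using bspec[OF meet that(1)] that(2) by fastforce
  have "\<exists>x\<in>carrier G. \<forall>i\<in>fst ` P. x \<in> g i <# H i"
  proof (rule assms)
    show "fst ` P \<subseteq> I" using P by auto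
    show "g \<in> fst ` P \<rightarrow> carrier G" using P g by auto
    show "(g i <# H i) \<inter> (g j <# H j) \<noteq> {}" if "i \<in> fst ` P" "j \<in> fst ` P" for i j
      by (rule meet'[OF g[OF that(1)] g[OF that(2)]])
  qed
  then obtain x where x: "x \<in> carrier G" "\<And>i. i \<in> fst ` P \<Longrightarrow> x \<in> g i <# H i" by blast
  have "x \<in> h <# H i" if ih: "(i, h) \<in> P" for i h
  proof -
    have i: "i \<in> fst ` P" using ih by force
    have c: "i \<in> I" "h \<in> carrier G" "g i \<in> carrier G" using P ih g[OF i] by auto
    obtain y where y: "y \<in> h <# H i" "y \<in> g i <# H i" using meet'[OF ih g[OF i]] by blast
    have "h <# H i = g i <# H i"
      using l_coset_eq[OF c(1,2) y(1)] l_coset_eq[OF c(1,3) y(2)] by simp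
    then show ?thesis using x(2)[OF i] by simp
  qed
  then show "\<exists>x\<in>carrier G. \<forall>(i, g)\<in>P. x \<in> g <# H i" using x(1) by blast
qed

section \<open>Flags and residues described by the cosets of one element\<close>

definition flag_at :: "'a \<Rightarrow> 'i set \<Rightarrow> ('i \<times> 'a set) set" where
  "flag_at x L = (\<lambda>i. (i, x <# H i)) ` L"

lemma flag_flag_at:
  assumes "L \<subseteq> I" "x \<in> carrier G"
  shows "flag S (flag_at x L)" "flag_type S (flag_at x L) = L"
proof -
  have "x \<in> x <# H i" if "i \<in> L" for i using l_coset_self assms that by blast
  then have "(x <# H i) \<inter> (x <# H j) \<noteq> {}" if "i \<in> L" "j \<in> L" for i j using that by blast
  then show "flag S (flag_at x L)" using assms by (fastforce simp: flag_def flag_at_def)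
  show "flag_type S (flag_at x L) = L" by (simp add: flag_at_def flag_type_def image_image)
qed

lemma left_translate_flag_at:
  assumes "L \<subseteq> I" "x \<in> carrier G" "g \<in> carrier G"
  shows "left_translate G g ` flag_at x L = flag_at (g \<otimes> x) L"
proof -
  have "g <# (x <# H i) = (g \<otimes> x) <# H i" if "i \<in> L" for i
    using lcos_m_assoc[OF subgroup.subset[OF H_subgroup]] assms that by blast
  then show ?thesis by (auto simp: flag_at_def left_translate_def image_image)
qed

text \<open>A common element of all members of \<open>F\<close>, supplied by the Helly property, can
  serve as representative of each of them.\<close>

lemma flag_eq_flag_at:
  assumes "helly G I H" "flag S F"
  obtains x where "x \<in> carrier G" "F = flag_at x (flag_type S F)"
proof -
  \<comment> \<open>All representatives of all members of \<open>F\<close> are collected, so none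
    has to be chosen.\<close>
  define P where "P = {(i, g). i \<in> I \<and> g \<in> carrier G \<and> (i, g <# H i) \<in> F}"
  have "(g <# H i) \<inter> (h <# H j) \<noteq> {}" if "(i, g) \<in> P" "(j, h) \<in> P" for i g j h
  proof -
    have "(i, g <# H i) \<in> F" "(j, h <# H j) \<in> F" using that by (auto simp: P_def)
    then have "incident S (i, g <# H i) (j, h <# H j)" using assms(2) unfolding flag_def by blast
    then show ?thesis by simp
  qed
  then obtain x where x: "x \<in> carrier G" "\<And>i g. (i, g) \<in> P \<Longrightarrow> x \<in> g <# H i"
    using hellyD[OF assms(1), of P] unfolding P_def by blast
  have F: "\<exists>i\<in>I. f = (i, x <# H i)" if f: "f \<in> F" for f
  proof -
    obtain i g where g: "i \<in> I" "g \<in> carrier G" "f = (i, g <# H i)"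
      using f assms(2) by (auto simp: flag_def)
    then have "x \<in> g <# H i" using x(2) f by (auto simp: P_def)
    then show ?thesis using g l_coset_eq by auto
  qed
  have "F = flag_at x (flag_type S F)"
    using F by (force simp: flag_at_def flag_type_def)
  then show ?thesis using that x(1) by blast
qed

lemma helly_imp_flag_transitive:
  assumes "helly G I H" shows "flag_transitive G I H"
  unfolding flag_transitive_def
proof (intro allI impI, elim conjE)
  fix L F F' assume L: "L \<subseteq> I" and F: "flag S F" "flag_type S F = L" "flag S F'" "flag_type S F' = L"
  obtain x y where xy: "x \<in> carrier G" "F = flag_at x L" "y \<in> carrier G" "F' = flag_at y L"
    using flag_eq_flag_at[OF assms F(1)] flag_eq_flag_at[OF assms F(3)] F by metis
  then have "left_translate G (y \<otimes> inv x) ` F = F'"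
    using left_translate_flag_at[OF L, of x "y \<otimes> inv x"] by (simp add: m_assoc)
  then show "\<exists>g\<in>carrier G. left_translate G g ` F = F'" using xy by blast
qed

text \<open>Pairwise meeting cosets form a flag \<open>F\<close>. An element that moves the flag of
  the subgroups themselves to \<open>F\<close> lies in all its members.\<close>

lemma flag_transitive_imp_helly:
  assumes "flag_transitive G I H" shows "helly G I H"
  unfolding helly_def
proof (intro allI impI)
  fix P assume P: "P \<subseteq> I \<times> carrier G"
    and meet: "\<forall>(i, g)\<in>P. \<forall>(j, h)\<in>P. (g <# H i) \<inter> (h <# H j) \<noteq> {}"
  define F where "F = (\<lambda>(i, g). (i, g <# H i)) ` P"
  have L: "fst ` P \<subseteq> I" using P by force
  have "incident S u v" if "u \<in> F" "v \<in> F" for u v using that meet by (force simp: F_def)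
  then have "flag S F" using P by (force simp: flag_def F_def)
  moreover have "flag_type S F = fst ` P" by (force simp: flag_type_def F_def)
  ultimately obtain x where x: "x \<in> carrier G" "left_translate G x ` flag_at \<one> (fst ` P) = F"
    using assms L flag_flag_at[OF L one_closed] unfolding flag_transitive_def by meson
  then have F: "F = flag_at x (fst ` P)" using left_translate_flag_at[OF L one_closed x(1)] by simp
  have "x \<in> g <# H i" if ig: "(i, g) \<in> P" for i g
  proof -
    have "(i, g <# H i) \<in> flag_at x (fst ` P)" using ig unfolding F[symmetric] F_def by force
    then have "g <# H i = x <# H i" by (auto simp: flag_at_def)
    then show ?thesis using l_coset_self x(1) P ig by auto
  qed
  then show "\<exists>x\<in>carrier G. \<forall>(i, g)\<in>P. x \<in> g <# H i" using x(1) by blast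
qed

text \<open>The cosets of \<open>x\<close> with types in \<open>flag_type S F\<close> extend to the
  cosets of \<open>x\<close> of all types, so a maximal flag already has every type.\<close>

lemma helly_imp_geometry:
  assumes "helly G I H" shows "geometry S"
  unfolding geometry_def
proof (intro allI impI)
  fix F assume F: "maximal_flag S F"
  then obtain x where x: "x \<in> carrier G" "F = flag_at x (flag_type S F)"
    using flag_eq_flag_at[OF assms] by (auto simp: maximal_flag_def)
  have "flag_type S F \<subseteq> I" using F by (auto simp: maximal_flag_def flag_def flag_type_def)
  then have "F \<subseteq> flag_at x I" by (subst x(2)) (auto simp: flag_at_def)
  then have "F = flag_at x I"
    using F flag_flag_at(1)[of I x] x(1) unfolding maximal_flag_def by blast
  then show "chamber S F" using flag_flag_at[of I x] x(1) by (simp add: chamber_def)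
qed

text \<open>The Helly property is applied to two cosets together with the members of
  \<open>flag_at x L\<close>. It supplies cosets in the residue of that flag with representatives in
  \<open>x <# par L\<close>.\<close>

lemma helly_extend:
  assumes "helly G I H" "L \<subseteq> I" "x \<in> carrier G"
    and "i \<in> I" "g \<in> carrier G" "j \<in> I" "h \<in> carrier G" "(g <# H i) \<inter> (h <# H j) \<noteq> {}"
    and "\<And>l. l \<in> L \<Longrightarrow> (g <# H i) \<inter> (x <# H l) \<noteq> {}" "\<And>l. l \<in> L \<Longrightarrow> (h <# H j) \<inter> (x <# H l) \<noteq> {}"
  obtains y where "y \<in> carrier G" "inv x \<otimes> y \<in> par L" "y \<in> g <# H i" "y \<in> h <# H j"
proof -
  define P where "P = insert (i, g) (insert (j, h) (L \<times> {x}))"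
  have "P \<subseteq> I \<times> carrier G" using assms by (auto simp: P_def)
  moreover have "(b <# H a) \<inter> (d <# H c) \<noteq> {}" if "(a, b) \<in> P" "(c, d) \<in> P" for a b c d
  proof -
    have "x \<in> x <# H l" if "l \<in> L" for l using that l_coset_self assms by blast
    moreover have "g \<in> g <# H i" "h \<in> h <# H j" using l_coset_self assms by blast+
    ultimately show ?thesis using that assms(8-10) unfolding P_def by blast
  qed
  ultimately obtain y where y: "y \<in> carrier G" "\<And>i g. (i, g) \<in> P \<Longrightarrow> y \<in> g <# H i"
    using hellyD[OF assms(1), of P] by blast
  have "inv x \<otimes> y \<in> H l" if "l \<in> L" for l
    using y(2)[of l x] that assms by (auto simp: P_def mem_l_coset_iff[OF H_subgroup])
  then have "inv x \<otimes> y \<in> par L" using y(1) assms by (simp add: parabolic_def)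
  then show ?thesis using that y by (auto simp: P_def)
qed

text \<open>A coset meeting all members of the flag has a representative in
  \<open>x <# par L\<close> by \<open>helly_extend\<close>. If its type were in \<open>L\<close>,
  the coset would itself belong to the flag.\<close>

lemma elements_residue:
  assumes "helly G I H" "L \<subseteq> I" "x \<in> carrier G"
  shows "elements (residue S (flag_at x L)) =
    {(i, (x \<otimes> k) <# H i) | i k. i \<in> I - L \<and> k \<in> par L}" (is "?l = ?r")
proof (intro equalityI subsetI)
  fix f assume f: "f \<in> ?l"
  then obtain i g where g: "i \<in> I" "g \<in> carrier G" "f = (i, g <# H i)" by (auto simp: residue_def)
  have inc: "(g <# H i) \<inter> (x <# H l) \<noteq> {}" if "l \<in> L" for l
    using f g that by (auto simp: residue_def flag_at_def)
  obtain y where y: "y \<in> carrier G" "inv x \<otimes> y \<in> par L" "y \<in> g <# H i"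
    using helly_extend[OF assms(1-3) g(1,2) g(1,2) _ inc inc] l_coset_self[OF g(1,2)] by blast
  have "x \<otimes> (inv x \<otimes> y) = y" using y assms by (simp add: m_assoc[symmetric])
  then have f': "f = (i, (x \<otimes> (inv x \<otimes> y)) <# H i)" using l_coset_eq[OF g(1,2) y(3)] g(3) by simp
  have "i \<notin> L"
  proof
    assume "i \<in> L"
    then have "y \<in> x <# H i" using y assms g by (auto simp: mem_l_coset_iff[OF H_subgroup] parabolic_def)
    then have "f \<in> flag_at x L"
      using l_coset_eq[OF g(1) assms(3)] l_coset_eq[OF g(1,2) y(3)] g \<open>i \<in> L\<close> by (auto simp: flag_at_def)
    then show False using f by (simp add: residue_def)
  qed
  then show "f \<in> ?r" using f' y(2) g(1) by blast
next
  fix f assume "f \<in> ?r"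
  then obtain i k where k: "i \<in> I - L" "k \<in> par L" "f = (i, (x \<otimes> k) <# H i)" by blast
  have kc: "k \<in> carrier G" using k by (simp add: parabolic_def)
  have "x \<otimes> k \<in> x <# H l" if "l \<in> L" for l
    using that k kc assms by (auto simp: mem_l_coset_iff[OF H_subgroup] m_assoc[symmetric] parabolic_def)
  moreover have "x \<otimes> k \<in> (x \<otimes> k) <# H i" using l_coset_self k kc assms by simp
  ultimately show "f \<in> ?l" using k kc assms unfolding residue_def flag_at_def by auto
qed

section \<open>Connected residues and generation of parabolic subgroups\<close>

lemma connected_imp_generate:
  assumes "helly G I H" "L \<subseteq> I" "s \<in> I - L"
    and con: "connected_incidence_graph (residue S (flag_at \<one> L))"
  shows "par L \<subseteq> generate G (\<Union>i\<in>I - L. par (insert i L))"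
proof
  fix k assume k: "k \<in> par L"
  define N where "N = generate G (\<Union>i\<in>I - L. par (insert i L))"
  have N: "subgroup N G" unfolding N_def
    by (rule generate_is_subgroup) (auto simp: parabolic_def)
  have inN: "y \<in> N" if "y \<in> par L" "y \<in> H i" "i \<in> I - L" for y i
    unfolding N_def by (rule generate.incl) (use that in \<open>auto simp: parabolic_def\<close>)
  note mem = elements_residue[OF assms(1,2) one_closed]
  define E where "E = elements (residue S (flag_at \<one> L))"
  have one: "\<one> \<in> par L" using subgroup.one_closed[OF par_subgroup[OF assms(2)]] .
  have car: "y \<in> carrier G" if "y \<in> par L" for y using that by (simp add: parabolic_def)
  have incl: "(y <# H i) \<inter> (\<one> <# H l) \<noteq> {}" if "y \<in> par L" "i \<in> I" "l \<in> L" for y i l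
  proof -
    have "y \<in> \<one> <# H l" using that car[OF that(1)] assms(2) by (auto simp: mem_l_coset_iff[OF H_subgroup] parabolic_def)
    then show ?thesis using l_coset_self[OF that(2) car[OF that(1)]] by blast
  qed
  have inE: "(s, k <# H s) \<in> E" "(s, \<one> <# H s) \<in> E"
    unfolding E_def mem using k one assms(3) car by force+
  then have "((s, \<one> <# H s), (s, k <# H s)) \<in>
      {(u, v). u \<in> E \<and> v \<in> E \<and> incident (residue S (flag_at \<one> L)) u v}\<^sup>*"
    using con unfolding connected_incidence_graph_def E_def by blast
  \<comment> \<open>Invariant along a path starting at \<open>H s\<close>: every representative in
    \<open>par L\<close> of the coset reached lies in \<open>N\<close>. At the end of the path
    \<open>k\<close> is such a representative.\<close>
  then have "\<forall>y\<in>par L. snd (s, k <# H s) = y <# H (fst (s, k <# H s)) \<longrightarrow> y \<in> N"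
  proof (induction rule: rtrancl_induct)
    case base
    show ?case
    proof (intro ballI impI)
      fix y assume y: "y \<in> par L" "snd (s, \<one> <# H s) = y <# H (fst (s, \<one> <# H s))"
      have "y \<in> \<one> <# H s" using l_coset_self[of s y] y assms(3) car by auto
      then have "y \<in> H s" using assms(3) car[OF y(1)] by (simp add: mem_l_coset_iff[OF H_subgroup])
      then show "y \<in> N" using inN y(1) assms(3) by blast
    qed
  next
    case (step u v)
    show ?case
    proof (intro ballI impI)
      fix y assume y: "y \<in> par L" "snd v = y <# H (fst v)"
      obtain i z where z: "i \<in> I - L" "z \<in> par L" "u = (i, (\<one> \<otimes> z) <# H i)"
        using step.hyps(2) unfolding E_def mem by blast
      obtain j where j: "j \<in> I - L" "fst v = j" using step.hyps(2) unfolding E_def mem by force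
      have zN: "z \<in> N" using step.IH z car by simp
      have "(z <# H i) \<inter> (y <# H j) \<noteq> {}"
        using step.hyps(2) y j z car by (simp add: residue_def)
      \<comment> \<open>Consecutive cosets share an element \<open>w\<close> of
        \<open>par L\<close>. It differs from \<open>z\<close> and from \<open>y\<close> by elements
        of \<open>par (insert i L)\<close> and \<open>par (insert j L)\<close>, which lie in
        \<open>N\<close>.\<close>
      then obtain w where w: "w \<in> carrier G" "inv \<one> \<otimes> w \<in> par L" "w \<in> z <# H i" "w \<in> y <# H j"
        using helly_extend[OF assms(1,2) one_closed _ car[OF z(2)] _ car[OF y(1)] _ incl[OF z(2)] incl[OF y(1)], of i j]
          z(1) j(1) by blast
      then have wP: "w \<in> par L" by simp
      have ij: "i \<in> I" "j \<in> I" using z j by auto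
      have "inv z \<otimes> w \<in> N" "inv y \<otimes> w \<in> N"
        using w(3,4) ij z(1) j(1) z(2) y(1) wP car
          subgroup.m_closed[OF par_subgroup[OF assms(2)]] subgroup.m_inv_closed[OF par_subgroup[OF assms(2)]]
        by (auto simp: mem_l_coset_iff[OF H_subgroup] intro: inN)
      then have "z \<otimes> (inv z \<otimes> w) \<otimes> inv (inv y \<otimes> w) \<in> N"
        by (rule subgroup.m_closed[OF N subgroup.m_closed[OF N zN] subgroup.m_inv_closed[OF N]])
      moreover have "z \<otimes> (inv z \<otimes> w) \<otimes> inv (inv y \<otimes> w) = y"
      proof -
        have "z \<otimes> (inv z \<otimes> w) = w" using car z(2) w(1) by (simp add: m_assoc[symmetric])
        moreover have "inv (inv y \<otimes> w) = inv w \<otimes> y" using car y(1) w(1) by (simp add: inv_mult_group)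
        ultimately show ?thesis using car y(1) w(1) by (simp add: m_assoc[symmetric])
      qed
      ultimately show "y \<in> N" by simp
    qed
  qed
  then show "k \<in> generate G (\<Union>i\<in>I - L. par (insert i L))" using k unfolding N_def by simp
qed

text \<open>A product of generators describes a path: for \<open>h\<close> in
  \<open>par (insert s L)\<close> the elements \<open>x \<otimes> k\<close> and
  \<open>x \<otimes> (k \<otimes> h)\<close> lie in the same coset of \<open>H s\<close>, and cosets
  with a common element are incident.\<close>

lemma generate_imp_connected:
  assumes "helly G I H" "L \<subseteq> I" "x \<in> carrier G"
    and gen: "par L \<subseteq> generate G (\<Union>i\<in>I - L. par (insert i L))"
  shows "connected_incidence_graph (residue S (flag_at x L))"
proof -
  define E where "E = elements (residue S (flag_at x L))"
  define R where "R = {(u, v). u \<in> E \<and> v \<in> E \<and> incident (residue S (flag_at x L)) u v}"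
  define c where "c i k = (i, (x \<otimes> k) <# H i)" for i k
  have mem: "E = {c i k | i k. i \<in> I - L \<and> k \<in> par L}"
    unfolding E_def c_def using elements_residue[OF assms(1-3)] .
  have car: "k \<in> carrier G" if "k \<in> par L" for k using that by (simp add: parabolic_def)
  note P = par_subgroup[OF assms(2)]
  have same: "(c i k, c j k) \<in> R" if "i \<in> I - L" "j \<in> I - L" "k \<in> par L" for i j k
  proof -
    have "x \<otimes> k \<in> (x \<otimes> k) <# H i" "x \<otimes> k \<in> (x \<otimes> k) <# H j"
      using l_coset_self that car assms by simp_all
    moreover have "c i k \<in> E" "c j k \<in> E" using mem that by blast+
    ultimately show ?thesis unfolding R_def by (auto simp: residue_def c_def)
  qed
  have move: "(c i k, c j (k \<otimes> h)) \<in> R\<^sup>*"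
    if "i \<in> I - L" "j \<in> I - L" "k \<in> par L" "s \<in> I - L" "h \<in> par (insert s L)" for i j k s h
  proof -
    have h: "h \<in> par L" "h \<in> H s" using that by (auto simp: parabolic_def)
    have kh: "k \<otimes> h \<in> par L" using subgroup.m_closed[OF P that(3) h(1)] .
    have "inv (x \<otimes> k) \<otimes> (x \<otimes> (k \<otimes> h)) = h"
      using car h(1) that(3) assms(3) by (simp add: inv_mult_group m_assoc) (simp add: m_assoc[symmetric])
    then have "x \<otimes> (k \<otimes> h) \<in> (x \<otimes> k) <# H s"
      using h(2) car that(3,4) kh assms(3) by (simp add: mem_l_coset_iff[OF H_subgroup])
    then have "c s k = c s (k \<otimes> h)"
      using l_coset_eq[of s "x \<otimes> k"] that(3,4) car assms(3) by (simp add: c_def)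
    then show ?thesis
      using same[OF that(1,4,3)] same[OF that(4,2) kh] by (auto intro: rtrancl_trans)
  qed
  \<comment> \<open>Quantifying over the start \<open>k\<close> and over both end types allows the
    paths of two factors to be joined.\<close>
  have walk: "u \<in> par L \<and> (\<forall>k\<in>par L. \<forall>i\<in>I - L. \<forall>j\<in>I - L. (c i k, c j (k \<otimes> u)) \<in> R\<^sup>*)"
    if "u \<in> generate G (\<Union>i\<in>I - L. par (insert i L))" for u
    using that
  proof (induction rule: generate.induct)
    case one
    then show ?case using same car subgroup.one_closed[OF P] by auto
  next
    case (incl h)
    then show ?case using move by (auto simp: parabolic_def)
  next
    case (inv h)
    then obtain s where s: "s \<in> I - L" "h \<in> par (insert s L)" by blast
    then have "inv h \<in> par (insert s L)"
      using subgroup.m_inv_closed[OF par_subgroup[of "insert s L"]] assms(2) by auto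
    moreover from this have "inv h \<in> par L" by (auto simp: parabolic_def)
    ultimately show ?case using move s(1) by blast
  next
    case (eng g h)
    have "(c i k, c j (k \<otimes> (g \<otimes> h))) \<in> R\<^sup>*" if "k \<in> par L" "i \<in> I - L" "j \<in> I - L" for i j k
    proof -
      have "(c i k, c i (k \<otimes> g)) \<in> R\<^sup>*" "(c i (k \<otimes> g), c j (k \<otimes> g \<otimes> h)) \<in> R\<^sup>*"
        using eng.IH that subgroup.m_closed[OF P that(1)] by blast+
      then show ?thesis using eng.IH that(1) car by (auto simp: m_assoc intro: rtrancl_trans)
    qed
    then show ?case using eng.IH subgroup.m_closed[OF P] by blast
  qed
  have "(u, v) \<in> R\<^sup>*" if uv: "u \<in> E" "v \<in> E" for u v
  proof -
    obtain i k j l where k: "i \<in> I - L" "k \<in> par L" "u = c i k" "j \<in> I - L" "l \<in> par L" "v = c j l"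
      using uv unfolding mem by blast
    have "inv k \<otimes> l \<in> par L" using subgroup.m_closed[OF P subgroup.m_inv_closed[OF P k(2)] k(5)] .
    then have "(c i k, c j (k \<otimes> (inv k \<otimes> l))) \<in> R\<^sup>*" using walk gen k by blast
    moreover have "k \<otimes> (inv k \<otimes> l) = l" using car k by (simp add: m_assoc[symmetric])
    ultimately show ?thesis using k by simp
  qed
  then show ?thesis unfolding connected_incidence_graph_def R_def E_def by blast
qed

lemma rank_residue: "L \<subseteq> I \<Longrightarrow> x \<in> carrier G \<Longrightarrow> rank (residue S (flag_at x L)) = card (I - L)"
  by (simp add: rank_def residue_def flag_flag_at)

lemma residually_connected_imp_generate:
  assumes "helly G I H" "residually_connected S" "L \<subseteq> I" "card (I - L) \<ge> 2"
  shows "par L \<subseteq> generate G (\<Union>i\<in>I - L. par (insert i L))"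
proof -
  have "I - L \<noteq> {}" using assms(4) by (metis card.empty not_numeral_le_zero)
  then obtain s where "s \<in> I - L" by blast
  moreover have "connected_incidence_graph (residue S (flag_at \<one> L))"
    using assms flag_flag_at[OF assms(3) one_closed] rank_residue[OF assms(3) one_closed]
    unfolding residually_connected_def by metis
  ultimately show ?thesis using connected_imp_generate assms by blast
qed

lemma generate_imp_residually_connected:
  assumes "helly G I H"
    and "\<And>L. L \<subseteq> I \<Longrightarrow> card (I - L) \<ge> 2 \<Longrightarrow> par L \<subseteq> generate G (\<Union>i\<in>I - L. par (insert i L))"
  shows "residually_connected S"
  unfolding residually_connected_def
proof (intro conjI allI impI)
  show "geometry S" using helly_imp_geometry assms(1) .
  fix F assume "flag S F \<and> 2 \<le> rank (residue S F)"
  then have F: "flag S F" "2 \<le> rank (residue S F)" by blast+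
  have L: "flag_type S F \<subseteq> I" using F by (auto simp: flag_def flag_type_def)
  obtain x where x: "x \<in> carrier G" "F = flag_at x (flag_type S F)"
    using flag_eq_flag_at[OF assms(1) F(1)] by blast
  have "card (I - flag_type S F) \<ge> 2" using F(2) rank_residue[OF L x(1)] x(2) by simp
  then show "connected_incidence_graph (residue S F)"
    using generate_imp_connected[OF assms(1) L x(1) assms(2)[OF L]] x(2) by simp
qed

section \<open>Firmness in terms of subgroups\<close>

lemma corank_flag_at: "corank S (flag_at x L) = card I - card L"
proof -
  have "card (flag_at x L) = card L" unfolding flag_at_def by (rule card_image) (simp add: inj_on_def)
  then show ?thesis by (simp add: corank_def rank_def)
qed

text \<open>Otherwise every coset in the residue of \<open>flag_at \<one> (I - {i})\<close> would
  equal \<open>H i\<close>, while firmness provides two of them.\<close>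

lemma firm_imp_not_subset:
  assumes "helly G I H" "finite I" "firm S" "i \<in> I"
  shows "\<not> par (I - {i}) \<subseteq> H i"
proof
  assume sub: "par (I - {i}) \<subseteq> H i"
  have L: "I - {i} \<subseteq> I" by blast
  have "card I > 0" using assms(2,4) card_gt_0_iff by blast
  then have "corank S (flag_at \<one> (I - {i})) = 1"
    using assms by (simp add: corank_flag_at)
  then obtain u v where uv: "u \<in> elements (residue S (flag_at \<one> (I - {i})))"
      "v \<in> elements (residue S (flag_at \<one> (I - {i})))" "u \<noteq> v"
    using assms(3) flag_flag_at(1)[OF L one_closed] unfolding firm_def by blast
  have "w = (i, \<one> <# H i)" if w: "w \<in> elements (residue S (flag_at \<one> (I - {i})))" for w
  proof -
    obtain j k where k: "j \<in> I - (I - {i})" "k \<in> par (I - {i})" "w = (j, (\<one> \<otimes> k) <# H j)"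
      using w unfolding elements_residue[OF assms(1) L one_closed] by blast
    then have kc: "k \<in> carrier G" "j = i" by (auto simp: parabolic_def)
    have "k \<in> \<one> <# H i" using k sub kc assms(4) by (auto simp: mem_l_coset_iff[OF H_subgroup])
    then show ?thesis using l_coset_eq[OF assms(4) one_closed] k kc by simp
  qed
  then show False using uv by metis
qed

text \<open>An element \<open>k\<close> of \<open>par (I - {i})\<close> outside \<open>H i\<close>
  yields two different cosets in the residue, those of \<open>x\<close> and of
  \<open>x \<otimes> k\<close>.\<close>

lemma not_subset_imp_firm:
  assumes "helly G I H" "finite I" "\<And>i. i \<in> I \<Longrightarrow> \<not> par (I - {i}) \<subseteq> H i"
  shows "firm S"
  unfolding firm_def
proof (intro conjI allI impI)
  show "geometry S" using helly_imp_geometry assms(1) .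
  fix F assume "flag S F \<and> corank S F = 1"
  then have F: "flag S F" "corank S F = 1" by blast+
  define L where "L = flag_type S F"
  have L: "L \<subseteq> I" using F by (auto simp: flag_def flag_type_def L_def)
  obtain x where x: "x \<in> carrier G" "F = flag_at x L"
    using flag_eq_flag_at[OF assms(1) F(1)] L_def by blast
  have "card (I - L) = 1"
    using F(2) assms(2) L by (simp add: x(2) corank_flag_at card_Diff_subset finite_subset)
  then obtain i where "I - L = {i}" by (auto simp: card_Suc_eq numeral_eq_Suc One_nat_def)
  then have i: "i \<in> I" "i \<notin> L" "L = I - {i}" using L by auto
  then obtain k where k: "k \<in> par L" "k \<notin> H i" using assms(3) by blast
  have kc: "k \<in> carrier G" using k by (simp add: parabolic_def)
  have "(i, (x \<otimes> k) <# H i) \<noteq> (i, (x \<otimes> \<one>) <# H i)"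
  proof
    assume "(i, (x \<otimes> k) <# H i) = (i, (x \<otimes> \<one>) <# H i)"
    then have "x \<otimes> k \<in> x <# H i" using l_coset_self[OF i(1), of "x \<otimes> k"] x(1) kc by simp
    then have "k \<in> H i" using x(1) kc i(1) by (simp add: mem_l_coset_iff[OF H_subgroup] m_assoc[symmetric])
    then show False using k(2) by simp
  qed
  moreover have "(i, (x \<otimes> k) <# H i) \<in> elements (residue S F)" "(i, (x \<otimes> \<one>) <# H i) \<in> elements (residue S F)"
    unfolding x(2) elements_residue[OF assms(1) L x(1)]
    using i k subgroup.one_closed[OF par_subgroup[OF L]] by blast+
  ultimately show "\<exists>x\<in>elements (residue S F). \<exists>y\<in>elements (residue S F). x \<noteq> y" by blast
qed

section \<open>Parabolic subgroups of Helly and residually connected systems\<close>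

lemma par_Un: "par (X \<union> Y) = par X \<inter> par Y"
  by (auto simp: parabolic_def)

lemma par_antimono: "X \<subseteq> Y \<Longrightarrow> par Y \<subseteq> par X"
  by (auto simp: parabolic_def)

lemma par_carrier [simp]: "a \<in> par X \<Longrightarrow> a \<in> carrier G"
  by (simp add: parabolic_def)

text \<open>A coset of \<open>par X\<close> is cut out of the group by the cosets of
  \<open>H i\<close> with \<open>i \<in> X\<close>; \<open>Q\<close> is the family of all these
  larger cosets.\<close>

lemma helly_par:
  assumes "helly G I H" "P \<subseteq> Pow I \<times> carrier G"
    and meet: "\<And>X g Y h. (X, g) \<in> P \<Longrightarrow> (Y, h) \<in> P \<Longrightarrow> (g <# par X) \<inter> (h <# par Y) \<noteq> {}"
  obtains x where "x \<in> carrier G" "\<And>X g. (X, g) \<in> P \<Longrightarrow> x \<in> g <# par X"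
proof -
  define Q where "Q = {(i, g). \<exists>X. (X, g) \<in> P \<and> i \<in> X}"
  have sub: "g <# par X \<subseteq> g <# H i" if "i \<in> X" for g X i
    using that by (auto simp: l_coset_def parabolic_def)
  have "Q \<subseteq> I \<times> carrier G" using assms(2) by (auto simp: Q_def)
  moreover have "(g <# H i) \<inter> (h <# H j) \<noteq> {}" if ij: "(i, g) \<in> Q" "(j, h) \<in> Q" for i g j h
  proof -
    obtain X Y where "(X, g) \<in> P" "i \<in> X" "(Y, h) \<in> P" "j \<in> Y" using ij unfolding Q_def by blast
    then show ?thesis using meet[of X g Y h] sub[of i X g] sub[of j Y h] by blast
  qed
  ultimately obtain x where x: "x \<in> carrier G" "\<And>i g. (i, g) \<in> Q \<Longrightarrow> x \<in> g <# H i"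
    using hellyD[OF assms(1)] by metis
  have "x \<in> g <# par X" if Xg: "(X, g) \<in> P" for X g
  proof -
    have X: "X \<subseteq> I" "g \<in> carrier G" using assms(2) Xg by auto
    have "inv g \<otimes> x \<in> H i" if "i \<in> X" for i
    proof -
      have "x \<in> g <# H i" using x(2) that Xg by (auto simp: Q_def)
      then show ?thesis using X that by (auto simp: mem_l_coset_iff[OF H_subgroup])
    qed
    then have "inv g \<otimes> x \<in> par X" using X(2) x(1) by (simp add: parabolic_def)
    then show ?thesis using X x(1) by (simp add: mem_l_coset_iff[OF par_subgroup])
  qed
  then show ?thesis using that x(1) by blast
qed

text \<open>Residual connectedness generates \<open>par X\<close> from the subgroups
  \<open>par (insert i X)\<close>. Iteration leads down to the parabolic subgroups that omit only
  one type.\<close>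

lemma par_le_minimal:
  assumes "helly G I H" "residually_connected S" "finite I" "subgroup N G"
    and "X \<subseteq> I" "X \<noteq> I" "\<And>j. j \<in> I - X \<Longrightarrow> par (I - {j}) \<subseteq> N"
  shows "par X \<subseteq> N"
  using assms(5-7)
proof (induction "card (I - X)" arbitrary: X rule: less_induct)
  case less
  have fin: "finite (I - X)" using assms(3) by simp
  obtain j where j: "j \<in> I - X" using less.prems by blast
  show ?case
  proof (cases "card (I - X) \<ge> 2")
    case True
    have "par (insert i X) \<subseteq> N" if i: "i \<in> I - X" for i
    proof (rule less.hyps)
      show "card (I - insert i X) < card (I - X)"
        using fin i by (intro psubset_card_mono) auto
      show "insert i X \<subseteq> I" using i less.prems by auto
      show "insert i X \<noteq> I"
      proof
        assume "insert i X = I"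
        then have "I - X \<subseteq> {i}" by blast
        then have "card (I - X) \<le> card {i}" by (intro card_mono) auto
        then show False using True by simp
      qed
      show "par (I - {k}) \<subseteq> N" if "k \<in> I - insert i X" for k using that less.prems(3) by auto
    qed
    then have "generate G (\<Union>i\<in>I - X. par (insert i X)) \<subseteq> N"
      by (intro generate_subgroup_incl assms(4)) auto
    then show ?thesis
      using residually_connected_imp_generate[OF assms(1,2) less.prems(1) True] by blast
  next
    case False
    have "card (I - X) \<noteq> 0" using j fin by auto
    then have "card (I - X) = 1" using False by simp
    then obtain k where k: "I - X = {k}" by (auto simp: card_1_singleton_iff)
    then have "X = I - {j}" using j less.prems(1) by auto
    then show ?thesis using less.prems(3) j by blast
  qed
qed

text \<open>A type \<open>j\<close> outside \<open>X \<inter> Y\<close> is missing from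
  \<open>X\<close> or from \<open>Y\<close>, so \<open>par (I - {j})\<close> lies in
  \<open>par X\<close> or in \<open>par Y\<close>.\<close>

lemma par_Int_le:
  assumes "helly G I H" "residually_connected S" "finite I" "subgroup N G"
    and "X \<subseteq> I" "Y \<subseteq> I" "par X \<subseteq> N" "par Y \<subseteq> N"
  shows "par (X \<inter> Y) \<subseteq> N"
proof (cases "X \<inter> Y = I")
  case True
  then have "X = I" using assms by auto
  then show ?thesis using assms True by simp
next
  case False
  show ?thesis
  proof (rule par_le_minimal[OF assms(1-4) _ False])
    show "X \<inter> Y \<subseteq> I" using assms by blast
    fix j assume "j \<in> I - X \<inter> Y"
    then have "X \<subseteq> I - {j} \<or> Y \<subseteq> I - {j}" using assms by blast
    then show "par (I - {j}) \<subseteq> N" using par_antimono assms(7,8) by blast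
  qed
qed

end

section \<open>Normal forms in HNN-extensions\<close>

text \<open>The Boolean \<open>e\<close> stands for the sign of an exponent: \<open>t\<^sup>-\<^sup>e c t\<^sup>e = p e c\<close> for \<open>c \<in> C e\<close>.\<close>

locale hnn = group A for A :: "('a, 'b) monoid_scheme" (structure) +
  fixes C :: "bool \<Rightarrow> 'a set" and p :: "bool \<Rightarrow> 'a \<Rightarrow> 'a"
  assumes C_subgroup: "subgroup (C e) A"
    and p_closed: "c \<in> C e \<Longrightarrow> p e c \<in> C (\<not> e)"
    and p_mult: "c \<in> C e \<Longrightarrow> c' \<in> C e \<Longrightarrow> p e (c \<otimes> c') = p e c \<otimes> p e c'"
    and p_inverse: "c \<in> C e \<Longrightarrow> p (\<not> e) (p e c) = c"
begin

section \<open>Associated subgroups and their coset representatives\<close>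

lemma C_carrier [simp]: "c \<in> C e \<Longrightarrow> c \<in> carrier A"
  using subgroup.mem_carrier[OF C_subgroup] .

lemma C_inv: "c \<in> C e \<Longrightarrow> inv c \<in> C e"
  using subgroup.m_inv_closed[OF C_subgroup] .

lemma C_one: "\<one> \<in> C e"
  using subgroup.one_closed[OF C_subgroup] .

lemma p_carrier [simp]: "c \<in> C e \<Longrightarrow> p e c \<in> carrier A"
  using p_closed C_carrier by blast

text \<open>Representatives are chosen in \<open>B\<close> where possible, so that the elements of \<open>\<langle>t, B\<rangle>\<close> have
  normal forms with all entries in \<open>B\<close>, see \<open>nf_gen\<close>.\<close>

definition rep :: "'a set \<Rightarrow> bool \<Rightarrow> 'a \<Rightarrow> 'a" where
  "rep B e a =
     (let X = a <# C e in
      if \<one> \<in> X then \<one> else if X \<inter> B \<noteq> {} then SOME r. r \<in> X \<inter> B else SOME r. r \<in> X)"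

lemma rep_mem: assumes "a \<in> carrier A" shows "rep B e a \<in> a <# C e"
proof -
  have "a \<in> a <# C e"
    using assms C_one by (simp add: mem_l_coset_iff[OF C_subgroup])
  then have "(SOME r. r \<in> a <# C e) \<in> a <# C e" by (metis someI)
  moreover have "(SOME r. r \<in> (a <# C e) \<inter> B) \<in> (a <# C e) \<inter> B" if "(a <# C e) \<inter> B \<noteq> {}"
    using that by (metis ex_in_conv someI)
  ultimately show ?thesis by (auto simp: rep_def Let_def)
qed

lemma rep_carrier [simp]: "a \<in> carrier A \<Longrightarrow> rep B e a \<in> carrier A"
  using rep_mem mem_l_coset_iff[OF C_subgroup] by blast

lemma rep_C: assumes "a \<in> carrier A" shows "inv (rep B e a) \<otimes> a \<in> C e"
proof -
  have "inv (inv a \<otimes> rep B e a) \<in> C e"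
    using rep_mem[OF assms] assms by (intro C_inv) (simp add: mem_l_coset_iff[OF C_subgroup])
  then show ?thesis using assms by (simp add: inv_mult_group)
qed

lemma rep_mult:
  assumes "a \<in> carrier A" "c \<in> C e" shows "rep B e (a \<otimes> c) = rep B e a"
proof -
  have "(a \<otimes> c) <# C e = a <# C e"
    using assms by (metis C_carrier C_subgroup l_coset_def lcos_m_assoc subgroup.subset coset_join3)
  then show ?thesis by (simp add: rep_def)
qed

text \<open>The trivial coset is represented by \<one>, so a possible cancellation shows in
  \<open>step\<close> as \<open>r = \<one>\<close>.\<close>

lemma rep_of_C: "c \<in> C e \<Longrightarrow> rep B e c = \<one>"
  by (simp add: rep_def mem_l_coset_iff[OF C_subgroup] C_inv)

text \<open>The coset contains \<open>a\<close> itself, so a choice inside \<open>B\<close> is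
  possible; the preferred representative \<one> lies in \<open>B\<close> too.\<close>

lemma rep_adapted:
  assumes "subgroup B A" "a \<in> B" shows "rep B e a \<in> B"
proof -
  have a: "a \<in> carrier A" using assms subgroup.mem_carrier by metis
  then have "a \<in> (a <# C e) \<inter> B"
    using assms(2) C_one by (simp add: mem_l_coset_iff[OF C_subgroup])
  then have "(a <# C e) \<inter> B \<noteq> {}" by blast
  then have "(SOME r. r \<in> (a <# C e) \<inter> B) \<in> (a <# C e) \<inter> B" by (metis ex_in_conv someI)
  then show ?thesis
    using \<open>(a <# C e) \<inter> B \<noteq> {}\<close> subgroup.one_closed[OF assms(1)] by (auto simp: rep_def Let_def)
qed

text \<open>The pair \<open>([(e\<^sub>n, r\<^sub>n), \<dots>, (e\<^sub>1, r\<^sub>1)], a)\<close> stands for \<open>r\<^sub>1 t\<^bsup>e\<^sub>1\<^esup> \<dots> r\<^sub>n t\<^bsup>e\<^sub>n\<^esup> a\<close>.\<close>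

type_synonym 'c state = "(bool \<times> 'c) list \<times> 'c"

text \<open>Right multiplication by t^e: write \<open>a = r \<otimes> c\<close> with
  \<open>c\<close> in \<open>C e\<close> and move \<open>c\<close> through the letter, where it
  becomes \<open>p e c\<close>. If \<open>r = \<one>\<close> and the preceding stable letter is
  t^-e, the two letters cancel.\<close>

fun step :: "'a set \<Rightarrow> bool \<Rightarrow> 'a state \<Rightarrow> 'a state" where
  "step B e (xs, a) =
     (let r = rep B e a; d = p e (inv r \<otimes> a)
      in if r = \<one> \<and> xs \<noteq> [] \<and> fst (hd xs) = (\<not> e) then (tl xs, snd (hd xs) \<otimes> d)
         else ((e, r) # xs, d))"

fun act :: "'a set \<Rightarrow> 'a hnn_letter \<Rightarrow> 'a state \<Rightarrow> 'a state" where
  "act B (Base a) (xs, x) = (xs, x \<otimes> a)"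
| "act B Stable st = step B True st"
| "act B StableInv st = step B False st"

text \<open>The head of the list is the last stable letter, so the final clause forbids a subword
  t^-e t^e.\<close>

fun reduced :: "'a set \<Rightarrow> (bool \<times> 'a) list \<Rightarrow> bool" where
  "reduced B [] = True"
| "reduced B ((e, r) # xs) \<longleftrightarrow>
     r \<in> carrier A \<and> rep B e r = r \<and> reduced B xs \<and> (r = \<one> \<and> xs \<noteq> [] \<longrightarrow> fst (hd xs) = e)"

definition valid :: "'a set \<Rightarrow> 'a state \<Rightarrow> bool" where
  "valid B st \<longleftrightarrow> reduced B (fst st) \<and> snd st \<in> carrier A"

lemma rep_rep: "a \<in> carrier A \<Longrightarrow> rep B e (rep B e a) = rep B e a"
  using rep_mult[of "rep B e a" "inv (rep B e a) \<otimes> a" e B] rep_C[of a B e]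
  by (simp add: m_assoc[symmetric])

lemma valid_step: assumes "valid B st" shows "valid B (step B e st)"
proof -
  obtain xs a where st: "st = (xs, a)" by (cases st)
  have a: "a \<in> carrier A" "reduced B xs" using assms by (auto simp: valid_def st)
  then have d: "p e (inv (rep B e a) \<otimes> a) \<in> carrier A" using rep_C by auto
  show ?thesis
    using a d rep_rep[of a B e] by (cases xs) (auto simp: st valid_def Let_def)
qed

text \<open>If the first step cancels an entry, the second pushes it back, since reducedness rules
  out another cancellation. If the first step pushes an entry, the second cancels it.\<close>

lemma step_step:
  assumes "valid B st" shows "step B (\<not> e) (step B e st) = st"
proof -
  obtain xs a where st: "st = (xs, a)" by (cases st)
  have a: "a \<in> carrier A" "reduced B xs" using assms by (auto simp: valid_def st)
  define r where "r = rep B e a"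
  define c where "c = inv r \<otimes> a"
  have r: "r \<in> carrier A" and c: "c \<in> C e" and rc: "r \<otimes> c = a"
    using a rep_C[of a B e] by (auto simp: r_def c_def m_assoc[symmetric])
  have pc: "p e c \<in> C (\<not> e)" using c by (rule p_closed)
  show ?thesis
  proof (cases "r = \<one> \<and> xs \<noteq> [] \<and> fst (hd xs) = (\<not> e)")
    case True
    then obtain s ys where xs: "xs = (\<not> e, s) # ys" by (cases xs) auto
    have s: "s \<in> carrier A" "rep B (\<not> e) s = s" using a(2) xs by auto
    have ca: "c = a" using True rc c by simp
    have "step B e st = (ys, s \<otimes> p e c)"
      using True a(1) by (simp add: st Let_def xs r_def[symmetric] ca)
    moreover have "rep B (\<not> e) (s \<otimes> p e c) = s" using rep_mult[OF s(1) pc] s(2) by simp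
    moreover have "inv s \<otimes> (s \<otimes> p e c) = p e c" using s c by (simp add: m_assoc[symmetric])
    moreover have "\<not> (s = \<one> \<and> ys \<noteq> [] \<and> fst (hd ys) = (\<not> \<not> e))" using a(2) xs by auto
    ultimately show ?thesis
      by (simp only: step.simps Let_def p_inverse[OF c] if_False simp_thms) (simp add: xs st ca)
  next
    case False
    have "step B e st = ((e, r) # xs, p e c)"
      using False by (auto simp add: st Let_def r_def[symmetric] c_def[symmetric])
    then show ?thesis
      using rep_of_C[OF pc] pc rc p_inverse[OF c] by (simp add: Let_def st)
  qed
qed

lemma step_conj:
  assumes "valid B (xs, x)" "c \<in> C e"
  shows "step B e (xs, x \<otimes> c) = (let st = step B e (xs, x) in (fst st, snd st \<otimes> p e c))"
proof -
  have x: "x \<in> carrier A" "reduced B xs" using assms by (auto simp: valid_def)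
  define r where "r = rep B e x"
  have r: "r \<in> carrier A" and d: "inv r \<otimes> x \<in> C e" using x rep_C[of x B e] by (auto simp: r_def)
  have "inv r \<otimes> (x \<otimes> c) = inv r \<otimes> x \<otimes> c" using r x assms(2) by (simp add: m_assoc)
  then have "p e (inv r \<otimes> (x \<otimes> c)) = p e (inv r \<otimes> x) \<otimes> p e c" using p_mult d assms(2) by simp
  moreover have "rep B e (x \<otimes> c) = r" using rep_mult x assms(2) by (simp add: r_def)
  moreover have "snd (hd xs) \<in> carrier A" if "xs \<noteq> []" using x(2) that by (cases xs) auto
  ultimately show ?thesis using d assms(2)
    by (auto simp: Let_def r_def[symmetric] m_assoc)
qed

section \<open>The action of words on reduced states\<close>

abbreviation run :: "'a set \<Rightarrow> 'a hnn_letter list \<Rightarrow> 'a state \<Rightarrow> 'a state" where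
  "run B w \<equiv> fold (act B) w"

abbreviation cong where "cong \<equiv> hnn_cong A (C True) (p True)"

lemma valid_act: "valid B st \<Longrightarrow> [l] \<in> hnn_words A \<Longrightarrow> valid B (act B l st)"
  by (cases l; cases st) (auto simp: valid_def[of _ "(_,_)"] hnn_words_def valid_step simp del: step.simps)

lemma valid_run: "w \<in> hnn_words A \<Longrightarrow> valid B st \<Longrightarrow> valid B (run B w st)"
proof (induction w arbitrary: st)
  case (Cons l w)
  then have "[l] \<in> hnn_words A" "w \<in> hnn_words A" by (auto simp: hnn_words_def)
  then show ?case using Cons valid_act by simp
qed simp

lemma assoc_laws: "group A" "C True \<subseteq> carrier A" "p True ` C True \<subseteq> carrier A"
  using is_group C_carrier p_carrier by blast+

text \<open>Van der Waerden's argument: both sides of every defining relation act alike on valid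
  states, so the group itself acts on them.\<close>

lemma run_cong: "(v, w) \<in> cong \<Longrightarrow> valid B st \<Longrightarrow> run B v st = run B w st"
proof (induction arbitrary: st rule: hnn_cong.induct)
  case (append v v' w w')
  then have "v \<in> hnn_words A" "v' \<in> hnn_words A" using hnn_cong_words[OF assoc_laws] by blast+
  then show ?case using append valid_run by simp
next
  case (base_mult a b)
  then show ?case by (cases st) (auto simp: valid_def m_assoc)
next
  case base_one
  then show ?case by (cases st) (auto simp: valid_def)
next
  case stable_inv
  then show ?case using step_step[of B st True] by simp
next
  case inv_stable
  then show ?case using step_step[of B st False] by simp
next
  case (conjugate a)
  obtain xs x where st: "step B False st = (xs, x)" by (cases "step B False st")
  have "valid B (xs, x)" using valid_step[OF conjugate(2), of False] st by simp
  \<comment> \<open>\<open>step_conj\<close> moves \<open>a\<close> through the final letter;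
    \<open>step_step\<close> then cancels the two opposite steps.\<close>
  then have "step B True (xs, x \<otimes> a) = (fst st, snd st \<otimes> p True a)"
    using step_conj[of B xs x a True] conjugate step_step[OF conjugate(2), of False]
    by (simp add: st Let_def del: step.simps)
  then show ?case using st by (cases st) (simp del: step.simps)
qed simp_all

section \<open>The HNN-extension and its normal form map\<close>

abbreviation G where "G \<equiv> hnn_extension A (C True) (p True)"

abbreviation base where "base \<equiv> hnn_base A (C True) (p True)"

definition stab :: "bool \<Rightarrow> 'a hnn_letter list set" where
  "stab e = (if e then hnn_stable A (C True) (p True) else cong `` {[StableInv]})"

lemma group_G: "group G"
  by (rule group_hnn_extension[OF assoc_laws])

sublocale G: group G
  by (rule group_G)

lemma one_G: "\<one>\<^bsub>G\<^esub> = cong `` {[]}"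
  by (simp add: hnn_extension_def)

lemma class_carrier: "w \<in> hnn_words A \<Longrightarrow> cong `` {w} \<in> carrier G"
  by (simp add: hnn_extension_def quotientI)

lemma base_carrier [simp]: "a \<in> carrier A \<Longrightarrow> base a \<in> carrier G"
  unfolding hnn_base_def by (rule class_carrier) (simp add: hnn_words_def)

lemma stab_carrier [simp]: "stab e \<in> carrier G"
  unfolding stab_def hnn_stable_def by (simp add: class_carrier hnn_words_def)

lemma class_eqI: "(v, w) \<in> cong \<Longrightarrow> cong `` {v} = cong `` {w}"
  by (rule equiv_class_eq[OF equiv_hnn_cong[OF assoc_laws]])

lemma base_mult: "a \<in> carrier A \<Longrightarrow> b \<in> carrier A \<Longrightarrow> base (a \<otimes> b) = base a \<otimes>\<^bsub>G\<^esub> base b"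
  unfolding hnn_base_def
  by (subst hnn_mult_class[OF assoc_laws])
     (auto simp: hnn_words_def intro!: class_eqI hnn_cong.sym[OF hnn_cong.base_mult])

lemma base_one: "base \<one> = \<one>\<^bsub>G\<^esub>"
  unfolding hnn_base_def one_G by (intro class_eqI hnn_cong.base_one)

lemma base_inv: "a \<in> carrier A \<Longrightarrow> base (inv a) = inv\<^bsub>G\<^esub> (base a)"
  using base_mult[of "inv a" a] by (intro G.inv_equality[symmetric]) (auto simp: base_one)

lemma stab_not: "stab e \<otimes>\<^bsub>G\<^esub> stab (\<not> e) = \<one>\<^bsub>G\<^esub>"
  unfolding stab_def hnn_stable_def one_G
  by (cases e) (auto simp: hnn_mult_class[OF assoc_laws] hnn_words_def
      intro!: class_eqI hnn_cong.stable_inv hnn_cong.inv_stable)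

lemma inv_stab: "inv\<^bsub>G\<^esub> (stab e) = stab (\<not> e)"
  using stab_not[of "\<not> e"] by (intro G.inv_equality) auto

lemma base_stab_True:
  assumes "c \<in> C True" shows "base c \<otimes>\<^bsub>G\<^esub> stab True = stab True \<otimes>\<^bsub>G\<^esub> base (p True c)"
proof -
  have "stab False \<otimes>\<^bsub>G\<^esub> base c \<otimes>\<^bsub>G\<^esub> stab True = base (p True c)"
    using assms unfolding stab_def hnn_stable_def hnn_base_def
    by (auto simp: hnn_mult_class[OF assoc_laws] hnn_words_def
        intro!: class_eqI hnn_cong.conjugate)
  then have "inv\<^bsub>G\<^esub> (stab True) \<otimes>\<^bsub>G\<^esub> (base c \<otimes>\<^bsub>G\<^esub> stab True) = base (p True c)"
    using assms by (simp add: inv_stab G.m_assoc)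
  then show ?thesis using assms by (metis G.inv_solve_left G.m_closed C_carrier base_carrier p_carrier stab_carrier)
qed

lemma base_stab:
  assumes "c \<in> C e" shows "base c \<otimes>\<^bsub>G\<^esub> stab e = stab e \<otimes>\<^bsub>G\<^esub> base (p e c)"
proof (cases e)
  case True
  then show ?thesis using base_stab_True assms by simp
next
  case False
  \<comment> \<open>The relation for the stable letter, applied to the element \<open>d\<close> with
    \<open>p True d = c\<close>, gives the one for its inverse.\<close>
  define d where "d = p e c"
  have d: "d \<in> C True" and pd: "p True d = c"
    using p_closed[OF assms] p_inverse[OF assms] False by (auto simp: d_def)
  have cc: "c \<in> carrier A" using assms by simp
  have "inv\<^bsub>G\<^esub> (stab True) \<otimes>\<^bsub>G\<^esub> base d = base c \<otimes>\<^bsub>G\<^esub> inv\<^bsub>G\<^esub> (stab True)"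
    using base_stab_True[OF d] d cc unfolding pd
    by (smt (verit) G.inv_closed G.inv_solve_left G.inv_solve_right G.m_assoc G.m_closed C_carrier base_carrier stab_carrier)
  then show ?thesis using False by (simp add: d_def inv_stab)
qed

text \<open>Every element is the class of a word, and letters are appended on the right, as in
  \<open>run\<close>.\<close>

lemma G_induct [consumes 1, case_names one base stab]:
  assumes "g \<in> carrier G"
    and "P \<one>\<^bsub>G\<^esub>"
    and "\<And>g a. g \<in> carrier G \<Longrightarrow> P g \<Longrightarrow> a \<in> carrier A \<Longrightarrow> P (g \<otimes>\<^bsub>G\<^esub> base a)"
    and "\<And>g e. g \<in> carrier G \<Longrightarrow> P g \<Longrightarrow> P (g \<otimes>\<^bsub>G\<^esub> stab e)"
  shows "P g"
proof -
  have "P (cong `` {w})" if "w \<in> hnn_words A" for w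
    using that
  proof (induction w rule: rev_induct)
    case Nil
    then show ?case using assms(2) by (simp add: one_G)
  next
    case (snoc l w)
    then have w: "w \<in> hnn_words A" and l: "[l] \<in> hnn_words A" by (auto simp: hnn_words_def)
    have eq: "cong `` {w @ [l]} = cong `` {w} \<otimes>\<^bsub>G\<^esub> cong `` {[l]}"
      using hnn_mult_class[OF assoc_laws w l] by simp
    show ?case
    proof (cases l)
      case (Base a)
      then have "a \<in> carrier A" using l by (auto simp: hnn_words_def)
      then show ?thesis unfolding eq unfolding Base using assms(3)[OF class_carrier[OF w] snoc.IH[OF w]]
        by (simp add: hnn_base_def)
    next
      case Stable
      then show ?thesis unfolding eq unfolding Stable
        using assms(4)[OF class_carrier[OF w] snoc.IH[OF w], of True]
        by (simp add: stab_def hnn_stable_def)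
    next
      case StableInv
      then show ?thesis unfolding eq unfolding StableInv
        using assms(4)[OF class_carrier[OF w] snoc.IH[OF w], of False]
        by (simp add: stab_def)
    qed
  qed
  moreover obtain w where "w \<in> hnn_words A" "g = cong `` {w}"
    using assms(1) by (auto simp: hnn_extension_def elim: quotientE)
  ultimately show ?thesis by blast
qed

text \<open>The word taken from the class \<open>g\<close> is arbitrary; \<open>run_cong\<close>
  makes the result independent of it.\<close>

definition nf :: "'a set \<Rightarrow> 'a hnn_letter list set \<Rightarrow> 'a state" where
  "nf B g = run B (SOME w. w \<in> g) ([], \<one>)"

lemma valid_start: "valid B ([], \<one>)"
  by (simp add: valid_def)

lemma nf_class:
  assumes "w \<in> hnn_words A" shows "nf B (cong `` {w}) = run B w ([], \<one>)"
proof -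
  have "w \<in> cong `` {w}" using assms hnn_cong.refl by blast
  then have "(SOME v. v \<in> cong `` {w}) \<in> cong `` {w}" by (metis someI)
  then have "(w, SOME v. v \<in> cong `` {w}) \<in> cong" by blast
  then show ?thesis unfolding nf_def using run_cong[OF _ valid_start] by metis
qed

lemma nf_mult_class:
  assumes "g \<in> carrier G" "w \<in> hnn_words A"
  shows "nf B (g \<otimes>\<^bsub>G\<^esub> cong `` {w}) = run B w (nf B g)"
proof -
  obtain v where v: "v \<in> hnn_words A" "g = cong `` {v}"
    using assms(1) by (auto simp: hnn_extension_def elim: quotientE)
  have "v @ w \<in> hnn_words A" using v assms by (auto simp: hnn_words_def)
  then show ?thesis unfolding v(2)
    using hnn_mult_class[OF assoc_laws v(1) assms(2)] nf_class v(1) by simp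
qed

lemma nf_one: "nf B \<one>\<^bsub>G\<^esub> = ([], \<one>)"
  unfolding one_G by (subst nf_class) (auto simp: hnn_words_def)

lemma nf_mult_base:
  assumes "g \<in> carrier G" "a \<in> carrier A"
  shows "nf B (g \<otimes>\<^bsub>G\<^esub> base a) = (fst (nf B g), snd (nf B g) \<otimes> a)"
  using nf_mult_class[OF assms(1), of "[Base a]"] assms(2)
  by (cases "nf B g") (auto simp: hnn_base_def hnn_words_def)

lemma nf_mult_stab:
  assumes "g \<in> carrier G"
  shows "nf B (g \<otimes>\<^bsub>G\<^esub> stab e) = step B e (nf B g)"
  using nf_mult_class[OF assms, of "[Stable]"] nf_mult_class[OF assms, of "[StableInv]"]
  by (cases e) (auto simp: stab_def hnn_stable_def hnn_words_def simp del: step.simps)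

lemma nf_valid:
  assumes "g \<in> carrier G" shows "valid B (nf B g)"
proof -
  obtain w where "w \<in> hnn_words A" "g = cong `` {w}"
    using assms by (auto simp: hnn_extension_def elim: quotientE)
  then show ?thesis using nf_class valid_run valid_start by metis
qed

lemma nf_snd_carrier [simp]: "g \<in> carrier G \<Longrightarrow> snd (nf B g) \<in> carrier A"
  using nf_valid[of g B] by (simp add: valid_def)

fun word_val :: "(bool \<times> 'a) list \<Rightarrow> 'a hnn_letter list set" where
  "word_val [] = \<one>\<^bsub>G\<^esub>"
| "word_val ((e, r) # xs) = word_val xs \<otimes>\<^bsub>G\<^esub> base r \<otimes>\<^bsub>G\<^esub> stab e"

lemma word_val_carrier: "reduced B xs \<Longrightarrow> word_val xs \<in> carrier G"
  by (induction xs rule: word_val.induct) auto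

lemma word_val_step:
  assumes "valid B (xs, a)" "step B e (xs, a) = (ys, b)"
  shows "word_val ys \<otimes>\<^bsub>G\<^esub> base b = word_val xs \<otimes>\<^bsub>G\<^esub> base a \<otimes>\<^bsub>G\<^esub> stab e"
proof -
  have a: "a \<in> carrier A" "reduced B xs" using assms by (auto simp: valid_def)
  define r where "r = rep B e a"
  define c where "c = inv r \<otimes> a"
  have r: "r \<in> carrier A" and c: "c \<in> C e" and rc: "r \<otimes> c = a"
    using a rep_C[of a B e] by (auto simp: r_def c_def m_assoc[symmetric])
  have X: "word_val xs \<in> carrier G" using a word_val_carrier by blast
  have *: "word_val xs \<otimes>\<^bsub>G\<^esub> base a \<otimes>\<^bsub>G\<^esub> stab e
      = word_val xs \<otimes>\<^bsub>G\<^esub> base r \<otimes>\<^bsub>G\<^esub> stab e \<otimes>\<^bsub>G\<^esub> base (p e c)"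
    using r c X unfolding rc[symmetric] by (simp add: base_mult G.m_assoc base_stab)
  show ?thesis
  proof (cases "r = \<one> \<and> xs \<noteq> [] \<and> fst (hd xs) = (\<not> e)")
    case True
    then obtain s zs where xs: "xs = (\<not> e, s) # zs" by (cases xs) auto
    have s: "s \<in> carrier A" "word_val zs \<in> carrier G" using a(2) xs word_val_carrier by auto
    have "c = a" using True rc c by simp
    then have "ys = zs" "b = s \<otimes> p e c"
      using assms(2) True a(1) by (simp_all add: Let_def xs r_def[symmetric])
    moreover have "word_val xs \<otimes>\<^bsub>G\<^esub> base r \<otimes>\<^bsub>G\<^esub> stab e = word_val zs \<otimes>\<^bsub>G\<^esub> base s"
      using stab_not[of "\<not> e"] s True by (simp add: xs base_one G.m_assoc)
    ultimately show ?thesis unfolding * using s c by (simp add: base_mult G.m_assoc)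
  next
    case False
    then have "ys = (e, r) # xs" "b = p e c"
      using assms(2) by (auto simp add: Let_def r_def[symmetric] c_def[symmetric] split: if_splits)
    then show ?thesis unfolding * by simp
  qed
qed

text \<open>A normal form determines its element, because each step multiplies the value of the
  state by the corresponding letter. \<open>vertex_eqD\<close> rests on this.\<close>

lemma nf_val:
  assumes "g \<in> carrier G" shows "word_val (fst (nf B g)) \<otimes>\<^bsub>G\<^esub> base (snd (nf B g)) = g"
  using assms
proof (induction rule: G_induct)
  case one
  then show ?case by (simp add: nf_one base_one)
next
  case (base g a)
  have "word_val (fst (nf B g)) \<in> carrier G"
    using nf_valid[OF base(1)] word_val_carrier by (auto simp: valid_def)
  then have "word_val (fst (nf B g)) \<otimes>\<^bsub>G\<^esub> (hnn.base A C p (snd (nf B g)) \<otimes>\<^bsub>G\<^esub> hnn.base A C p a)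
     = g \<otimes>\<^bsub>G\<^esub> hnn.base A C p a"
    using base by (simp add: G.m_assoc[symmetric])
  then show ?case using base by (simp add: nf_mult_base base_mult)
next
  case (stab g e)
  obtain ys b where "step B e (nf B g) = (ys, b)" by fastforce
  then show ?case using word_val_step[of B "fst (nf B g)" "snd (nf B g)" e ys b] nf_valid[OF stab(1)] stab
    by (simp add: nf_mult_stab del: step.simps)
qed

section \<open>Subgroups generated by the stable letter and part of the base\<close>

definition stable :: "'a set \<Rightarrow> bool" where
  "stable B \<longleftrightarrow> subgroup B A \<and> (\<forall>e. p e ` (B \<inter> C e) \<subseteq> B)"

definition gen :: "'a set \<Rightarrow> 'a hnn_letter list set set" where
  "gen B = generate G (insert (hnn_stable A (C True) (p True)) (base ` B))"

lemma stable_carrier: "stable B \<Longrightarrow> B \<subseteq> carrier A"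
  by (simp add: stable_def subgroup.subset)

lemma gen_subgroup: "B \<subseteq> carrier A \<Longrightarrow> subgroup (gen B) G"
  unfolding gen_def
  by (rule G.generate_is_subgroup) (use stab_carrier[of True] base_carrier in \<open>auto simp: stab_def\<close>)

lemma gen_base: "b \<in> B \<Longrightarrow> base b \<in> gen B"
  unfolding gen_def by (rule generate.incl) simp

lemma gen_stab: "stab e \<in> gen B"
proof -
  have "stab True \<in> gen B" unfolding gen_def by (rule generate.incl) (simp add: stab_def)
  moreover have "inv\<^bsub>G\<^esub> (stab True) \<in> gen B" unfolding gen_def by (rule generate.inv) (simp add: stab_def)
  ultimately show ?thesis by (cases e) (auto simp: inv_stab)
qed

lemma gen_mono: "B \<subseteq> B' \<Longrightarrow> gen B \<subseteq> gen B'"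
  unfolding gen_def by (rule G.mono_generate) auto

lemma gen_leI:
  assumes "subgroup N G" "stab True \<in> N" "base ` B \<subseteq> N" shows "gen B \<subseteq> N"
  unfolding gen_def by (rule G.generate_subgroup_incl) (use assms in \<open>auto simp: stab_def\<close>)

lemma gen_induct [consumes 2, case_names one base stab]:
  assumes B: "subgroup B A" and u: "u \<in> gen B"
    and one: "P \<one>\<^bsub>G\<^esub>"
    and base: "\<And>g b. g \<in> gen B \<Longrightarrow> P g \<Longrightarrow> b \<in> B \<Longrightarrow> P (g \<otimes>\<^bsub>G\<^esub> base b)"
    and stab: "\<And>g e. g \<in> gen B \<Longrightarrow> P g \<Longrightarrow> P (g \<otimes>\<^bsub>G\<^esub> stab e)"
  shows "P u"
proof -
  have N: "subgroup (gen B) G" by (rule gen_subgroup[OF subgroup.subset[OF B]])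
  \<comment> \<open>The claim is strengthened to preservation of \<open>P\<close> under right
    multiplication by \<open>u\<close>, which passes to products.\<close>
  have "u \<in> gen B \<and> (\<forall>v\<in>gen B. P v \<longrightarrow> P (v \<otimes>\<^bsub>G\<^esub> u))"
    using u unfolding gen_def
  proof (induction rule: generate.induct)
    case one
    then show ?case using subgroup.mem_carrier[OF N] subgroup.one_closed[OF N] by (simp add: gen_def)
  next
    case (incl h)
    then consider "h = stab True" | b where "b \<in> B" "h = hnn.base A C p b" by (auto simp: stab_def)
    then have "\<forall>v\<in>gen B. P v \<longrightarrow> P (v \<otimes>\<^bsub>G\<^esub> h)" by cases (auto intro: base stab)
    then show ?case using generate.incl[OF incl] by (simp add: gen_def)
  next
    case (inv h)
    then consider "h = stab True" | b where "b \<in> B" "h = hnn.base A C p b" by (auto simp: stab_def)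
    then have "\<forall>v\<in>gen B. P v \<longrightarrow> P (v \<otimes>\<^bsub>G\<^esub> inv\<^bsub>G\<^esub> h)"
    proof cases
      case 1
      then show ?thesis using stab[of _ False] by (simp add: inv_stab)
    next
      case 2
      then have "inv\<^bsub>G\<^esub> h = hnn.base A C p (inv b)" "inv b \<in> B"
        using B base_inv subgroup.mem_carrier[OF B] subgroup.m_inv_closed[OF B] by auto
      then show ?thesis using base by auto
    qed
    then show ?case using generate.inv[OF inv] by (simp add: gen_def)
  next
    case (eng h k)
    then have hk: "h \<in> gen B" "k \<in> gen B" by (simp_all add: gen_def)
    then have hk': "h \<in> carrier G" "k \<in> carrier G" using subgroup.mem_carrier[OF N] by blast+
    have "P (v \<otimes>\<^bsub>G\<^esub> (h \<otimes>\<^bsub>G\<^esub> k))" if v: "v \<in> gen B" "P v" for v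
    proof -
      have "P (v \<otimes>\<^bsub>G\<^esub> h)" "v \<otimes>\<^bsub>G\<^esub> h \<in> gen B"
        using eng v hk subgroup.m_closed[OF N] by (auto simp: gen_def)
      then have "P (v \<otimes>\<^bsub>G\<^esub> h \<otimes>\<^bsub>G\<^esub> k)" using eng by (auto simp: gen_def)
      then show ?thesis using hk' v subgroup.mem_carrier[OF N v(1)] by (simp add: G.m_assoc)
    qed
    then show ?case using subgroup.m_closed[OF N hk] by (simp add: gen_def)
  qed
  then have "P (\<one>\<^bsub>G\<^esub> \<otimes>\<^bsub>G\<^esub> u)" using one subgroup.one_closed[OF N] by blast
  then show ?thesis using subgroup.mem_carrier[OF N u] by simp
qed

definition adapted :: "'a set \<Rightarrow> 'a state set" where
  "adapted B = {st. snd ` set (fst st) \<subseteq> B \<and> snd st \<in> B}"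

text \<open>The representative of \<open>a\<close> can be taken in \<open>B\<close>, so the
  remaining factor lies in \<open>B \<inter> C e\<close>, and stability keeps its image under
  \<open>p e\<close> in \<open>B\<close>.\<close>

lemma step_adapted:
  assumes "stable B" "st \<in> adapted B" shows "step B e st \<in> adapted B"
proof -
  obtain xs a where st: "st = (xs, a)" by (cases st)
  have B: "subgroup B A" using assms(1) by (simp add: stable_def)
  have a: "a \<in> B" "snd ` set xs \<subseteq> B" using assms(2) by (auto simp: adapted_def st)
  have r: "rep B e a \<in> B" using rep_adapted B a by blast
  have "inv (rep B e a) \<otimes> a \<in> B \<inter> C e"
    using r a B rep_C[of a B e] by (auto intro: subgroup.m_closed subgroup.m_inv_closed subgroup.mem_carrier)
  then have "p e (inv (rep B e a) \<otimes> a) \<in> B" using assms(1) unfolding stable_def by blast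
  moreover have "snd ` set (tl xs) \<subseteq> B" "xs \<noteq> [] \<Longrightarrow> snd (hd xs) \<in> B" using a(2) by (cases xs; auto)+
  ultimately show ?thesis using a r B
    by (auto simp: st adapted_def Let_def intro: subgroup.m_closed)
qed

lemma nf_gen:
  assumes "stable B" "u \<in> gen B" shows "nf B u \<in> adapted B"
proof -
  have B: "subgroup B A" using assms(1) by (simp add: stable_def)
  have N: "g \<in> gen B \<Longrightarrow> g \<in> carrier G" for g
    using subgroup.mem_carrier[OF gen_subgroup[OF subgroup.subset[OF B]]] .
  show ?thesis
    using B assms(2)
  proof (induction rule: gen_induct)
    case one
    then show ?case using B by (simp add: nf_one adapted_def subgroup.one_closed)
  next
    case (base g b)
    then show ?case using nf_mult_base[OF N[OF base.hyps(1)] subgroup.mem_carrier[OF B base.hyps(2)]] B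
      by (auto simp: adapted_def subgroup.m_closed)
  next
    case (stab g e)
    then show ?case using step_adapted[OF assms(1)] N nf_mult_stab by simp
  qed
qed

text \<open>The normal form of \<open>base a\<close> is \<open>([], a)\<close>, and
  \<open>nf_gen\<close> puts its last entry into \<open>B\<close>.\<close>

lemma gen_Int_base:
  assumes "stable B" "a \<in> carrier A" "base a \<in> gen B" shows "a \<in> B"
  using nf_gen[OF assms(1,3)] nf_mult_base[of "\<one>\<^bsub>G\<^esub>" a B] assms(2)
  by (simp add: nf_one adapted_def)

text \<open>The only stable letter of the normal form is preceded by the representative of
  \<open>x <# C e\<close>. As this representative lies in \<open>B\<close>, the coset meets
  \<open>B\<close>.\<close>

lemma gen_edge:
  assumes "stable B" "x \<in> carrier A" "y \<in> carrier A"
    and "base x \<otimes>\<^bsub>G\<^esub> stab e \<otimes>\<^bsub>G\<^esub> base y \<in> gen B"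
  shows "\<exists>b\<in>B. inv x \<otimes> b \<in> C e"
proof -
  have "nf B (base x) = ([], x)" using nf_mult_base[of "\<one>\<^bsub>G\<^esub>" x B] assms by (simp add: nf_one)
  then have "fst (nf B (base x \<otimes>\<^bsub>G\<^esub> stab e \<otimes>\<^bsub>G\<^esub> base y)) = [(e, rep B e x)]"
    using assms by (simp add: nf_mult_base nf_mult_stab Let_def)
  then have "rep B e x \<in> B" using nf_gen[OF assms(1,4)] by (simp add: adapted_def)
  then show ?thesis using rep_mem[of x B e] assms by (auto simp: mem_l_coset_iff[OF C_subgroup])
qed

section \<open>The Bass-Serre tree\<close>

text \<open>\<open>vertex g\<close> encodes the vertex \<open>gA\<close> of the Bass-Serre tree of the HNN-extension; the tail of
  the list is the neighbour of this vertex that is closer to the vertex \<open>A\<close>.\<close>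

abbreviation vertex :: "'a hnn_letter list set \<Rightarrow> (bool \<times> 'a) list" where
  "vertex g \<equiv> fst (nf {} g)"

lemma vertex_one: "vertex \<one>\<^bsub>G\<^esub> = []"
  by (simp add: nf_one)

lemma vertex_base: "g \<in> carrier G \<Longrightarrow> a \<in> carrier A \<Longrightarrow> vertex (g \<otimes>\<^bsub>G\<^esub> base a) = vertex g"
  by (simp add: nf_mult_base)

text \<open>Normal forms with the same list differ only in their last entry, which lies in the base
  group; so equal lists mean equal cosets of the base.\<close>

lemma vertex_eqD:
  assumes "g \<in> carrier G" "h \<in> carrier G" "vertex g = vertex h"
  obtains a where "a \<in> carrier A" "h = g \<otimes>\<^bsub>G\<^esub> base a"
proof
  define w where "w = word_val (vertex g)"
  define x where "x = snd (nf {} g)"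
  define y where "y = snd (nf {} h)"
  have w: "w \<in> carrier G" and x: "x \<in> carrier A" and y: "y \<in> carrier A"
    using assms nf_valid[of g "{}"] word_val_carrier unfolding w_def x_def y_def
    by (auto simp: valid_def)
  have g: "w \<otimes>\<^bsub>G\<^esub> base x = g" "w \<otimes>\<^bsub>G\<^esub> base y = h"
    using nf_val[of g "{}"] nf_val[of h "{}"] assms by (simp_all add: w_def x_def y_def)
  show "inv x \<otimes> y \<in> carrier A" using x y by simp
  have "base x \<otimes>\<^bsub>G\<^esub> base (inv x \<otimes> y) = base y" using x y by (simp add: base_mult[symmetric] m_assoc[symmetric])
  then show "h = g \<otimes>\<^bsub>G\<^esub> base (inv x \<otimes> y)" unfolding g[symmetric] using x y w by (simp add: G.m_assoc)
qed

text \<open>A stable letter either adds an entry or cancels one: it leads to a child or to the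
  parent.\<close>

lemma vertex_stab:
  assumes "g \<in> carrier G"
  shows "(\<exists>y. vertex (g \<otimes>\<^bsub>G\<^esub> stab e) = y # vertex g) \<or>
    vertex g \<noteq> [] \<and> vertex (g \<otimes>\<^bsub>G\<^esub> stab e) = tl (vertex g)"
  by (cases "nf {} g") (auto simp: nf_mult_stab[OF assms] Let_def)

text \<open>Membership in \<open>C (\<not> e)\<close> makes the representative \<one>, so the
  appended letter cancels the last stable letter.\<close>

lemma vertex_back:
  assumes "g \<in> carrier G" "nf {} g = ((e, r) # xs, x)" "b \<in> carrier A" "x \<otimes> b \<in> C (\<not> e)"
  shows "vertex (g \<otimes>\<^bsub>G\<^esub> base b \<otimes>\<^bsub>G\<^esub> stab (\<not> e)) = xs"
  using assms rep_of_C[OF assms(4), of "{}"] by (simp add: nf_mult_stab nf_mult_base Let_def)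

text \<open>A walk starting at the vertex \<open>gA\<close> stays among its descendants unless it passes through the
  parent of \<open>gA\<close>.\<close>

lemma gen_walk:
  assumes "subgroup B A" "g \<in> carrier G" "u \<in> gen B"
  shows "suffix (vertex g) (vertex (g \<otimes>\<^bsub>G\<^esub> u)) \<or>
    vertex g \<noteq> [] \<and> (\<exists>v\<in>gen B. vertex (g \<otimes>\<^bsub>G\<^esub> v) = tl (vertex g))"
proof -
  note N = gen_subgroup[OF subgroup.subset[OF assms(1)]]
  show ?thesis
    using assms(1,3)
  proof (induction rule: gen_induct)
    case one
    then show ?case using assms(2) by simp
  next
    case (base h b)
    have "vertex (g \<otimes>\<^bsub>G\<^esub> (h \<otimes>\<^bsub>G\<^esub> hnn.base A C p b)) = vertex (g \<otimes>\<^bsub>G\<^esub> h)"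
      using vertex_base[of "g \<otimes>\<^bsub>G\<^esub> h" b] subgroup.mem_carrier[OF N base.hyps(1)]
        subgroup.mem_carrier[OF assms(1) base.hyps(2)] assms(2) by (simp add: G.m_assoc)
    then show ?case using base.IH by simp
  next
    case (stab h e)
    have h: "h \<in> carrier G" using subgroup.mem_carrier[OF N stab.hyps(1)] .
    have he: "h \<otimes>\<^bsub>G\<^esub> hnn.stab A C p e \<in> gen B" using subgroup.m_closed[OF N stab.hyps(1) gen_stab] .
    show ?case
    proof (cases "suffix (vertex g) (vertex (g \<otimes>\<^bsub>G\<^esub> h))")
      case True
      then obtain zs where zs: "vertex (g \<otimes>\<^bsub>G\<^esub> h) = zs @ vertex g" by (auto simp: suffix_def)
      consider y where "vertex (g \<otimes>\<^bsub>G\<^esub> (h \<otimes>\<^bsub>G\<^esub> hnn.stab A C p e)) = y # zs @ vertex g"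
        | "zs @ vertex g \<noteq> []" "vertex (g \<otimes>\<^bsub>G\<^esub> (h \<otimes>\<^bsub>G\<^esub> hnn.stab A C p e)) = tl (zs @ vertex g)"
        using vertex_stab[of "g \<otimes>\<^bsub>G\<^esub> h" e] assms(2) h zs by (auto simp: G.m_assoc)
      then show ?thesis
      proof cases
        case 1
        then show ?thesis by (simp add: suffix_def)
      next
        case 2
        then show ?thesis using he by (cases zs) (auto simp: suffix_def)
      qed
    next
      case False
      then show ?thesis using stab.IH by blast
    qed
  qed
qed

text \<open>By \<open>gen_walk\<close>, a subtree that comes nearer to the root than the vertex of
  \<open>g\<close> contains the parent of this vertex. \<open>gen_edge\<close> turns the edge to the
  parent into an element of \<open>B\<close>.\<close>

lemma gen_parent:
  assumes "stable B" "g \<in> carrier G" "u \<in> gen B" "nf {} g = ((e, r) # xs, x)"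
    and "length (vertex (g \<otimes>\<^bsub>G\<^esub> u)) < length (vertex g)"
  shows "\<exists>b\<in>B. x \<otimes> b \<in> C (\<not> e)"
proof -
  have B: "subgroup B A" using assms(1) by (simp add: stable_def)
  have "\<not> suffix (vertex g) (vertex (g \<otimes>\<^bsub>G\<^esub> u))" using assms(5) suffix_length_le by fastforce
  then obtain v where v: "v \<in> gen B" "vertex (g \<otimes>\<^bsub>G\<^esub> v) = tl (vertex g)"
    using gen_walk[OF B assms(2,3)] by blast
  have vc: "v \<in> carrier G" using subgroup.mem_carrier[OF gen_subgroup[OF subgroup.subset[OF B]] v(1)] .
  have x: "x \<in> carrier A" using nf_snd_carrier[OF assms(2), of "{}"] assms(4) by simp
  \<comment> \<open>The choice \<open>b = inv x\<close> makes \<open>x \<otimes> b\<close> equal to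
    \<one>, an element of \<open>C (\<not> e)\<close>; this gives an explicit element over the
    parent.\<close>
  have "vertex (g \<otimes>\<^bsub>G\<^esub> base (inv x) \<otimes>\<^bsub>G\<^esub> stab (\<not> e)) = vertex (g \<otimes>\<^bsub>G\<^esub> v)"
    using vertex_back[OF assms(2,4), of "inv x"] x C_one v assms(4) by simp
  then obtain a where a: "a \<in> carrier A"
      "g \<otimes>\<^bsub>G\<^esub> v = g \<otimes>\<^bsub>G\<^esub> base (inv x) \<otimes>\<^bsub>G\<^esub> stab (\<not> e) \<otimes>\<^bsub>G\<^esub> base a"
    using vertex_eqD[of "g \<otimes>\<^bsub>G\<^esub> base (inv x) \<otimes>\<^bsub>G\<^esub> stab (\<not> e)" "g \<otimes>\<^bsub>G\<^esub> v"] assms(2) vc x by auto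
  then have "v = base (inv x) \<otimes>\<^bsub>G\<^esub> stab (\<not> e) \<otimes>\<^bsub>G\<^esub> base a"
    using assms(2) vc x by (simp add: G.m_assoc)
  then show ?thesis using gen_edge[OF assms(1), of "inv x" a "\<not> e"] x a v by auto
qed

text \<open>The condition under which a common element of two cosets can be moved to an adjacent vertex of
  the tree; for parabolic subgroups it is an instance of the Helly property.\<close>

definition compatible :: "'a set \<Rightarrow> 'a set \<Rightarrow> bool" where
  "compatible B B' \<longleftrightarrow>
     (\<forall>e x b b'. x \<in> carrier A \<and> b \<in> B \<and> b' \<in> B' \<and> x \<otimes> b \<in> C e \<and> x \<otimes> b' \<in> C e \<longrightarrow>
        (\<exists>c\<in>B \<inter> B'. x \<otimes> c \<in> C e))"

section \<open>Common elements of two cosets\<close>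

lemma gen_base_stab:
  assumes "B \<subseteq> carrier A" "c \<in> B" shows "base c \<otimes>\<^bsub>G\<^esub> stab e \<in> gen B"
  using subgroup.m_closed[OF gen_subgroup[OF assms(1)] gen_base[OF assms(2)] gen_stab] .

text \<open>Both subtrees through the vertex of \<open>z\<close> reach nearer vertices, so both
  contain the edge to its parent. Compatibility makes one element of \<open>B \<inter> B'\<close>
  serve for both.\<close>

lemma descent:
  assumes "stable B" "stable B'" "compatible B B'" "z \<in> carrier G"
    and "u \<in> gen B" "length (vertex (z \<otimes>\<^bsub>G\<^esub> u)) < length (vertex z)"
    and "u' \<in> gen B'" "length (vertex (z \<otimes>\<^bsub>G\<^esub> u')) < length (vertex z)"
  shows "\<exists>c e. c \<in> B \<inter> B' \<and> length (vertex (z \<otimes>\<^bsub>G\<^esub> base c \<otimes>\<^bsub>G\<^esub> stab e)) < length (vertex z)"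
proof -
  obtain e r xs x where nf: "nf {} z = ((e, r) # xs, x)"
    using assms(6) by (cases "nf {} z"; cases "vertex z") auto
  have x: "x \<in> carrier A" using nf_snd_carrier[OF assms(4), of "{}"] nf by simp
  obtain b b' where "b \<in> B" "x \<otimes> b \<in> C (\<not> e)" "b' \<in> B'" "x \<otimes> b' \<in> C (\<not> e)"
    using gen_parent[OF assms(1,4,5) nf assms(6)] gen_parent[OF assms(2,4,7) nf assms(8)] by blast
  then obtain c where c: "c \<in> B \<inter> B'" "x \<otimes> c \<in> C (\<not> e)"
    using assms(3) x unfolding compatible_def by blast
  then have "c \<in> carrier A" using stable_carrier[OF assms(1)] by blast
  then show ?thesis using vertex_back[OF assms(4) nf _ c(2)] c(1) nf
    by (intro exI[of _ c] exI[of _ "\<not> e"]) simp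
qed

text \<open>Induction on the distance of the vertex of \<open>z\<close> from the root. Right
  multiplication by the inverse of \<open>z\<close> leads to the root inside both subgroups, so
  \<open>descent\<close> applies until \<open>z\<close> lies in the base, where
  \<open>gen_Int_base\<close> decides.\<close>

lemma gen_Int:
  assumes "stable B" "stable B'" "compatible B B'"
  shows "gen B \<inter> gen B' = gen (B \<inter> B')"
proof
  show "gen (B \<inter> B') \<subseteq> gen B \<inter> gen B'" by (simp add: gen_mono)
  have BA: "B \<subseteq> carrier A" "B' \<subseteq> carrier A" "B \<inter> B' \<subseteq> carrier A" using stable_carrier assms by blast+
  note N = BA[THEN gen_subgroup]
  have "z \<in> gen (B \<inter> B')" if "z \<in> gen B" "z \<in> gen B'" for z
    using that
  proof (induction "length (vertex z)" arbitrary: z rule: less_induct)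
    case less
    have z: "z \<in> carrier G" using less.prems(1) subgroup.mem_carrier[OF N(1)] by blast
    show ?case
    proof (cases "vertex z = []")
      case True
      then obtain a where a: "a \<in> carrier A" "z = \<one>\<^bsub>G\<^esub> \<otimes>\<^bsub>G\<^esub> base a"
        using vertex_eqD[of "\<one>\<^bsub>G\<^esub>" z] z vertex_one by auto
      then have "a \<in> B \<inter> B'" using gen_Int_base assms less.prems by simp
      then show ?thesis using a gen_base by simp
    next
      case False
      then have short: "length (vertex (z \<otimes>\<^bsub>G\<^esub> inv\<^bsub>G\<^esub> z)) < length (vertex z)"
        using z by (simp add: vertex_one)
      have "inv\<^bsub>G\<^esub> z \<in> gen B" "inv\<^bsub>G\<^esub> z \<in> gen B'" using less.prems subgroup.m_inv_closed[OF N(1)] subgroup.m_inv_closed[OF N(2)] by blast+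
      then obtain c e where c: "c \<in> B \<inter> B'"
          "length (vertex (z \<otimes>\<^bsub>G\<^esub> base c \<otimes>\<^bsub>G\<^esub> stab e)) < length (vertex z)"
        using descent[OF assms z _ short _ short] by blast
      define k where "k = base c \<otimes>\<^bsub>G\<^esub> stab e"
      have k: "k \<in> gen B" "k \<in> gen B'" "k \<in> gen (B \<inter> B')"
        using c(1) gen_base_stab[OF BA(1)] gen_base_stab[OF BA(2)] gen_base_stab[OF BA(3)] by (auto simp: k_def)
      have kc: "k \<in> carrier G" using k(1) subgroup.mem_carrier[OF N(1)] by blast
      have "c \<in> carrier A" using c BA by auto
      then have zk: "z \<otimes>\<^bsub>G\<^esub> k = z \<otimes>\<^bsub>G\<^esub> base c \<otimes>\<^bsub>G\<^esub> stab e" unfolding k_def using z by (simp add: G.m_assoc)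
      have "z \<otimes>\<^bsub>G\<^esub> k \<in> gen (B \<inter> B')"
        using less.prems subgroup.m_closed[OF N(1) _ k(1)] subgroup.m_closed[OF N(2) _ k(2)] c(2)
        by (intro less.hyps) (simp_all add: zk[symmetric])
      then have "z \<otimes>\<^bsub>G\<^esub> k \<otimes>\<^bsub>G\<^esub> inv\<^bsub>G\<^esub> k \<in> gen (B \<inter> B')"
        by (rule subgroup.m_closed[OF N(3) _ subgroup.m_inv_closed[OF N(3) k(3)]])
      then show ?thesis using z kc by (simp add: G.m_assoc)
    qed
  qed
  then show "gen B \<inter> gen B' \<subseteq> gen (B \<inter> B')" by blast
qed

text \<open>Take a common element \<open>x\<close> with vertex as near to the root as possible. If
  both cosets reached nearer vertices, \<open>descent\<close> would move \<open>x\<close> to a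
  nearer common element.\<close>

lemma meet_nearest:
  assumes "stable B" "stable B'" "compatible B B'"
    and "y \<in> carrier G" "y' \<in> carrier G" "(y <#\<^bsub>G\<^esub> gen B) \<inter> (y' <#\<^bsub>G\<^esub> gen B') \<noteq> {}"
  obtains x where "x \<in> y <#\<^bsub>G\<^esub> gen B" "x \<in> y' <#\<^bsub>G\<^esub> gen B'"
    "(\<forall>u\<in>gen B. length (vertex x) \<le> length (vertex (x \<otimes>\<^bsub>G\<^esub> u))) \<or>
     (\<forall>u\<in>gen B'. length (vertex x) \<le> length (vertex (x \<otimes>\<^bsub>G\<^esub> u)))"
proof -
  have BA: "B \<subseteq> carrier A" "B' \<subseteq> carrier A" using stable_carrier assms by blast+
  note N = BA[THEN gen_subgroup]
  define Y where "Y = (y <#\<^bsub>G\<^esub> gen B) \<inter> (y' <#\<^bsub>G\<^esub> gen B')"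
  obtain x0 where "x0 \<in> Y" using assms(6) by (auto simp: Y_def)
  then obtain x where x: "x \<in> Y"
    and min: "\<And>z. z \<in> Y \<Longrightarrow> length (vertex x) \<le> length (vertex z)"
    using ex_has_least_nat[of "\<lambda>x. x \<in> Y" x0 "\<lambda>x. length (vertex x)"] by blast
  have xc: "x \<in> carrier G" using x assms(4) by (simp add: Y_def G.mem_l_coset_iff[OF N(1)])
  have "(\<forall>u\<in>gen B. length (vertex x) \<le> length (vertex (x \<otimes>\<^bsub>G\<^esub> u))) \<or>
     (\<forall>u\<in>gen B'. length (vertex x) \<le> length (vertex (x \<otimes>\<^bsub>G\<^esub> u)))"
  proof (rule ccontr)
    assume "\<not> ?thesis"
    then obtain u u' where "u \<in> gen B" "length (vertex (x \<otimes>\<^bsub>G\<^esub> u)) < length (vertex x)"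
        "u' \<in> gen B'" "length (vertex (x \<otimes>\<^bsub>G\<^esub> u')) < length (vertex x)"
      by (auto simp: not_le)
    from descent[OF assms(1-3) xc this] obtain c e where c: "c \<in> B \<inter> B'"
        "length (vertex (x \<otimes>\<^bsub>G\<^esub> base c \<otimes>\<^bsub>G\<^esub> stab e)) < length (vertex x)"
      by blast
    define k where "k = base c \<otimes>\<^bsub>G\<^esub> stab e"
    have k: "k \<in> gen B" "k \<in> gen B'"
      using c(1) gen_base_stab[OF BA(1)] gen_base_stab[OF BA(2)] by (auto simp: k_def)
    have kc: "k \<in> carrier G" using subgroup.mem_carrier[OF N(1) k(1)] .
    have "c \<in> carrier A" using c BA by auto
    then have xk: "x \<otimes>\<^bsub>G\<^esub> k = x \<otimes>\<^bsub>G\<^esub> base c \<otimes>\<^bsub>G\<^esub> stab e" unfolding k_def using xc by (simp add: G.m_assoc)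
    have "inv\<^bsub>G\<^esub> w \<otimes>\<^bsub>G\<^esub> (x \<otimes>\<^bsub>G\<^esub> k) = inv\<^bsub>G\<^esub> w \<otimes>\<^bsub>G\<^esub> x \<otimes>\<^bsub>G\<^esub> k" if "w \<in> carrier G" for w
      using that xc kc by (simp add: G.m_assoc)
    then have "x \<otimes>\<^bsub>G\<^esub> k \<in> Y"
      using x assms(4,5) kc xc subgroup.m_closed[OF N(1) _ k(1)] subgroup.m_closed[OF N(2) _ k(2)]
      by (simp add: Y_def G.mem_l_coset_iff[OF N(1)] G.mem_l_coset_iff[OF N(2)])
    then show False using min[of "x \<otimes>\<^bsub>G\<^esub> k"] c(2) xk by simp
  qed
  then show ?thesis using that x unfolding Y_def by blast
qed

text \<open>From a nearest vertex no walk in the subtree reaches its parent. By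
  \<open>gen_walk\<close> it only meets descendants, and these are farther away unless they are the
  vertex itself.\<close>

lemma nearest_unique:
  assumes "subgroup B A" "x \<in> carrier G" "u \<in> gen B"
    and "\<forall>u\<in>gen B. length (vertex x) \<le> length (vertex (x \<otimes>\<^bsub>G\<^esub> u))"
    and "length (vertex (x \<otimes>\<^bsub>G\<^esub> u)) \<le> length (vertex x)"
  shows "vertex (x \<otimes>\<^bsub>G\<^esub> u) = vertex x"
proof -
  have "vertex (x \<otimes>\<^bsub>G\<^esub> v) \<noteq> tl (vertex x)" if "v \<in> gen B" "vertex x \<noteq> []" for v
  proof -
    have "length (tl (vertex x)) < length (vertex x)" using that by simp
    then show ?thesis using assms(4) that(1) by (metis not_le)
  qed
  then have "suffix (vertex x) (vertex (x \<otimes>\<^bsub>G\<^esub> u))" using gen_walk[OF assms(1-3)] by blast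
  then show ?thesis using assms(5) by (auto simp: suffix_def)
qed

end

section \<open>Flag-transitivity of the HNN-extension\<close>

locale admissible_system = coset_data A I H
  for A :: "('a, 'b) monoid_scheme" (structure) and I :: "'i set" and H +
  fixes J K :: "'i set" and \<phi> :: "'a \<Rightarrow> 'a"
  assumes finite_I: "finite I" and J: "J \<subseteq> I" and K: "K \<subseteq> I"
    and adm: "admissible A I H J K \<phi>"
    and hel: "helly A I H"
begin

definition C :: "bool \<Rightarrow> 'a set" where "C e = (if e then par J else par K)"

definition p :: "bool \<Rightarrow> 'a \<Rightarrow> 'a" where
  "p e = (if e then \<phi> else the_inv_into (par J) \<phi>)"

lemma p_True: "C True = par J" "p True = \<phi>"
  by (simp_all add: C_def p_def)

lemma phi_bij: "bij_betw \<phi> (par J) (par K)"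
  using adm by (simp add: admissible_def iso_def)

lemma phi_mult: "a \<in> par J \<Longrightarrow> b \<in> par J \<Longrightarrow> \<phi> (a \<otimes> b) = \<phi> a \<otimes> \<phi> b"
  using adm by (simp add: admissible_def iso_def hom_def)

lemma phi_inj: "inj_on \<phi> (par J)"
  using phi_bij by (simp add: bij_betw_def)

lemma phi_image: "\<phi> ` par J = par K"
  using phi_bij by (simp add: bij_betw_def)

sublocale hnn A C p
proof (intro hnn.intro hnn_axioms.intro)
  show "group A" by (rule is_group)
  fix e
  show "subgroup (C e) A" using par_subgroup J K by (simp add: C_def)
  fix c assume c: "c \<in> C e"
  have inv_mem: "the_inv_into (par J) \<phi> x \<in> par J" "\<phi> (the_inv_into (par J) \<phi> x) = x" if "x \<in> par K" for x
    using that phi_image the_inv_into_into[OF phi_inj, of x] f_the_inv_into_f[OF phi_inj, of x] by auto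
  show "p e c \<in> C (\<not> e)" using c phi_image inv_mem by (auto simp: C_def p_def)
  show "p (\<not> e) (p e c) = c"
    using c inv_mem the_inv_into_f_f[OF phi_inj] by (auto simp: C_def p_def)
  fix d assume d: "d \<in> C e"
  show "p e (c \<otimes> d) = p e c \<otimes> p e d"
  proof (cases e)
    case True
    then show ?thesis using c d phi_mult by (simp add: C_def p_def)
  next
    case False
    define a b where "a = the_inv_into (par J) \<phi> c" and "b = the_inv_into (par J) \<phi> d"
    have "c = \<phi> a" "d = \<phi> b" "a \<in> par J" "b \<in> par J"
      using c d False inv_mem by (simp_all add: C_def a_def b_def)
    moreover from this have "a \<otimes> b \<in> par J" using subgroup.m_closed[OF par_subgroup[OF J]] by blast
    ultimately show ?thesis
      using False the_inv_into_f_f[OF phi_inj] phi_mult by (simp add: p_def flip: phi_mult)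
  qed
qed

text \<open>For closed \<open>X\<close> the subgroup \<open>\<langle>t, A\<^sub>X\<rangle>\<close> is the HNN-extension of \<open>A\<^sub>X\<close> along a restriction
  of \<open>\<phi>\<close>.\<close>

definition closed :: "'i set \<Rightarrow> bool" where
  "closed X \<longleftrightarrow> X \<subseteq> I \<and> \<phi> ` par (X \<union> J) = par (X \<union> K)"

section \<open>Closed type sets and intersections of their subgroups\<close>

lemma closed_empty: "closed {}"
  by (simp add: closed_def phi_image)

text \<open>Injectivity of \<phi> makes taking images commute with intersection.\<close>

lemma closed_Un: assumes "closed X" "closed Y" shows "closed (X \<union> Y)"
proof -
  have "par (X \<union> Y \<union> J) = par (X \<union> J) \<inter> par (Y \<union> J)" "par (X \<union> Y \<union> K) = par (X \<union> K) \<inter> par (Y \<union> K)"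
    by (auto simp: parabolic_def)
  moreover have "\<phi> ` (par (X \<union> J) \<inter> par (Y \<union> J)) = \<phi> ` par (X \<union> J) \<inter> \<phi> ` par (Y \<union> J)"
    by (rule inj_on_image_Int[OF phi_inj]) (auto simp: parabolic_def)
  ultimately show ?thesis using assms by (auto simp: closed_def)
qed

lemma closed_Union: "finite U \<Longrightarrow> (\<And>X. X \<in> U \<Longrightarrow> closed X) \<Longrightarrow> closed (\<Union>U)"
  by (induction U rule: finite_induct) (auto intro: closed_Un closed_empty)

text \<open>Closedness says that \<phi> maps \<open>par X \<inter> par J\<close> onto
  \<open>par X \<inter> par K\<close>, which settles both signs.\<close>

lemma closed_stable: assumes "closed X" shows "stable (par X)"
  unfolding stable_def
proof (intro conjI allI)
  show "subgroup (par X) A" using assms par_subgroup by (simp add: closed_def)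
  fix e
  show "p e ` (par X \<inter> C e) \<subseteq> par X"
  proof (cases e)
    case True
    have "\<phi> ` (par X \<inter> par J) = par X \<inter> par K" using assms by (simp add: closed_def par_Un)
    then show ?thesis using True by (auto simp: C_def p_def)
  next
    case False
    have "p e x \<in> par X" if "x \<in> par X \<inter> C e" for x
    proof -
      have "x \<in> \<phi> ` (par X \<inter> par J)" using assms that False by (simp add: closed_def par_Un C_def)
      then obtain y where "x = \<phi> y" "y \<in> par X" "y \<in> par J" by blast
      then show ?thesis using False the_inv_into_f_f[OF phi_inj] by (simp add: p_def)
    qed
    then show ?thesis by blast
  qed
qed

text \<open>The set of \<open>c\<close> with \<open>x \<otimes> c \<in> C e\<close> is a coset of
  \<open>par J\<close> or \<open>par K\<close> with representative \<open>inv x\<close>. Together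
  with \<open>par X\<close> and \<open>par Y\<close> it forms a pairwise meeting family.\<close>

lemma compatible_par:
  assumes "X \<subseteq> I" "Y \<subseteq> I" shows "compatible (par X) (par Y)"
  unfolding compatible_def
proof (intro allI impI, elim conjE)
  fix e x b b'
  assume x: "x \<in> carrier A" and b: "b \<in> par X" "b' \<in> par Y" "x \<otimes> b \<in> C e" "x \<otimes> b' \<in> C e"
  define Z where "Z = (if e then J else K)"
  have Z: "Z \<subseteq> I" "C e = par Z" using J K by (auto simp: Z_def C_def)
  have bc: "b \<in> carrier A" "b' \<in> carrier A" using b by auto
  note iff = mem_l_coset_iff[OF par_subgroup]
  have self: "g \<in> g <# par W" if "W \<subseteq> I" "g \<in> carrier A" for g W
    using that subgroup.one_closed[OF par_subgroup] by (simp add: iff)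
  have m: "b \<in> \<one> <# par X" "b \<in> inv x <# par Z" "b' \<in> \<one> <# par Y" "b' \<in> inv x <# par Z"
    "\<one> \<in> \<one> <# par X" "\<one> \<in> \<one> <# par Y" "inv x \<in> inv x <# par Z"
    using b bc x Z assms self by (simp_all add: iff)
  define P where "P = {(X, \<one>), (Y, \<one>), (Z, inv x)}"
  have "P \<subseteq> Pow I \<times> carrier A" using assms Z x by (auto simp: P_def)
  moreover have "(g <# par V) \<inter> (h <# par W) \<noteq> {}" if "(V, g) \<in> P" "(W, h) \<in> P" for V g W h
    using that m unfolding P_def by (elim insertE emptyE; clarsimp) blast+
  ultimately obtain c where c: "c \<in> carrier A" "\<And>V g. (V, g) \<in> P \<Longrightarrow> c \<in> g <# par V"
    using helly_par[OF hel, of P] by blast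
  have "c \<in> \<one> <# par X" "c \<in> \<one> <# par Y" "c \<in> inv x <# par Z" using c(2) by (simp_all add: P_def)
  then have "c \<in> par X" "c \<in> par Y" "x \<otimes> c \<in> C e" using assms Z x by (simp_all add: iff)
  then show "\<exists>c\<in>par X \<inter> par Y. x \<otimes> c \<in> C e" by blast
qed

lemma gen_par_Union:
  assumes "finite U" "\<And>X. X \<in> U \<Longrightarrow> closed X"
  shows "carrier G \<inter> (\<Inter>X\<in>U. gen (par X)) = gen (par (\<Union>U))"
  using assms
proof (induction U rule: finite_induct)
  case empty
  \<comment> \<open>The empty union has \<open>par {} = carrier A\<close>, and the stable letter and
    the base generate the whole group.\<close>
  have "g \<in> gen (carrier A)" if "g \<in> carrier G" for g
  proof -
    have N: "subgroup (gen (carrier A)) G" by (rule gen_subgroup) simp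
    show ?thesis using that
      by (induction rule: G_induct)
        (auto intro: gen_base gen_stab subgroup.one_closed[OF N] subgroup.m_closed[OF N])
  qed
  moreover have "gen (carrier A) \<subseteq> carrier G" using subgroup.subset[OF gen_subgroup] by simp
  ultimately show ?case by (auto simp: parabolic_def)
next
  case (insert X U)
  have X: "closed X" "closed (\<Union>U)" using insert closed_Union by auto
  have "carrier G \<inter> (\<Inter>X\<in>insert X U. gen (par X)) = gen (par X) \<inter> gen (par (\<Union>U))"
    using insert by auto
  also have "\<dots> = gen (par X \<inter> par (\<Union>U))"
    using X by (intro gen_Int closed_stable compatible_par) (auto simp: closed_def)
  also have "\<dots> = gen (par (\<Union>(insert X U)))" by (simp add: par_Un)
  finally show ?case .
qed

section \<open>The induced lattice isomorphism and the classes of types\<close>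

lemma lattice_iso:
  obtains \<psi> where "bij_betw \<psi> {L. J \<subseteq> L \<and> L \<subseteq> I} {M. K \<subseteq> M \<and> M \<subseteq> I}"
    "\<And>L M. J \<subseteq> L \<Longrightarrow> L \<subseteq> I \<Longrightarrow> J \<subseteq> M \<Longrightarrow> M \<subseteq> I \<Longrightarrow> \<psi> L \<subseteq> \<psi> M \<longleftrightarrow> L \<subseteq> M"
    "\<And>L. J \<subseteq> L \<Longrightarrow> L \<subseteq> I \<Longrightarrow> \<phi> ` par L = par (\<psi> L)"
proof -
  obtain \<psi> where \<psi>: "bij_betw \<psi> {L. J \<subseteq> L \<and> L \<subseteq> I} {M. K \<subseteq> M \<and> M \<subseteq> I}"
    "\<forall>L M. J \<subseteq> L \<and> L \<subseteq> I \<and> J \<subseteq> M \<and> M \<subseteq> I \<longrightarrow> \<psi> (L \<union> M) = \<psi> L \<union> \<psi> M"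
    "\<forall>L. J \<subseteq> L \<and> L \<subseteq> I \<longrightarrow> \<phi> ` par L = par (\<psi> L)"
    using adm unfolding admissible_def by (elim conjE exE) (rule that)
  have "\<psi> L \<subseteq> \<psi> M \<longleftrightarrow> L \<subseteq> M" if L: "J \<subseteq> L" "L \<subseteq> I" and M: "J \<subseteq> M" "M \<subseteq> I" for L M
  proof -
    \<comment> \<open>Inclusion is expressed by unions, so injectivity and preservation of unions
      give an order isomorphism.\<close>
    have "\<psi> (L \<union> M) = \<psi> M \<longleftrightarrow> L \<union> M = M"
      using inj_onD[OF bij_betw_imp_inj_on[OF \<psi>(1)], of "L \<union> M" M] L M by auto
    moreover have "\<psi> (L \<union> M) = \<psi> L \<union> \<psi> M" using \<psi>(2) L M by blast
    ultimately show ?thesis by (simp add: subset_Un_eq)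
  qed
  then show ?thesis using that[OF \<psi>(1)] \<psi>(3) by simp
qed

abbreviation E where "E \<equiv> hnn_type_equiv A I H J K \<phi>"

definition type_step :: "('i \<times> 'i) set" where
  "type_step = {(i, j). i \<in> I - J \<and> j \<in> I - K \<and> \<phi> ` par (J \<union> {i}) = par (K \<union> {j})}"

lemma E_eq: "E = (type_step \<union> type_step\<inverse>)\<^sup>* \<inter> I \<times> I"
  by (simp add: hnn_type_equiv_def type_step_def Let_def)

lemma equiv_E: "equiv I E"
proof (rule equivI)
  have "sym ((type_step \<union> type_step\<inverse>)\<^sup>*)" by (intro sym_rtrancl symI) auto
  then show "sym E" unfolding E_eq by (auto simp: sym_def)
  show "trans E" unfolding E_eq by (auto simp: trans_def intro: rtrancl_trans)
qed (auto simp: E_eq refl_on_def)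

lemma class_subset: "s \<in> I // E \<Longrightarrow> s \<subseteq> I"
  by (auto simp: quotient_def E_eq)

lemma finite_classes: "finite (I // E)"
  by (rule finite_subset[OF _ finite_Pow_iff[THEN iffD2, OF finite_I]]) (use class_subset in blast)

lemma class_step:
  assumes "s \<in> I // E" "(i, j) \<in> type_step" shows "i \<in> s \<longleftrightarrow> j \<in> s"
proof -
  have "(i, j) \<in> E" using assms(2) unfolding E_eq by (auto simp: type_step_def)
  then have "j \<in> s" if "i \<in> s" using that assms(1) in_quotient_imp_closed[OF equiv_E] by blast
  moreover have "(j, i) \<in> E" using \<open>(i, j) \<in> E\<close> equiv_E unfolding equiv_def by (blast dest: symD)
  then have "i \<in> s" if "j \<in> s" using that assms(1) in_quotient_imp_closed[OF equiv_E] by blast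
  ultimately show ?thesis by blast
qed

text \<open>An order isomorphism between the intervals from \<open>J\<close> to \<open>I\<close> and
  from \<open>K\<close> to \<open>I\<close> preserves least elements and atoms. It thus matches the
  types outside \<open>J\<close> with those outside \<open>K\<close>.\<close>

lemma atoms:
  assumes \<psi>: "bij_betw \<psi> {L. J \<subseteq> L \<and> L \<subseteq> I} {M. K \<subseteq> M \<and> M \<subseteq> I}"
    "\<And>L M. J \<subseteq> L \<Longrightarrow> L \<subseteq> I \<Longrightarrow> J \<subseteq> M \<Longrightarrow> M \<subseteq> I \<Longrightarrow> \<psi> L \<subseteq> \<psi> M \<longleftrightarrow> L \<subseteq> M"
  shows "\<psi> J = K" "i \<in> I - J \<Longrightarrow> \<exists>k\<in>I - K. \<psi> (J \<union> {i}) = K \<union> {k}"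
    "k \<in> I - K \<Longrightarrow> \<exists>i\<in>I - J. \<psi> (J \<union> {i}) = K \<union> {k}"
proof -
  have surj: "\<exists>L. J \<subseteq> L \<and> L \<subseteq> I \<and> \<psi> L = M" if "K \<subseteq> M" "M \<subseteq> I" for M
    proof -
    have "M \<in> \<psi> ` {L. J \<subseteq> L \<and> L \<subseteq> I}" using bij_betw_imp_surj_on[OF \<psi>(1)] that by simp
    then show ?thesis by blast
  qed
  have in_range: "K \<subseteq> \<psi> L" "\<psi> L \<subseteq> I" if "J \<subseteq> L" "L \<subseteq> I" for L
    using bij_betwE[OF \<psi>(1)] that by auto
  obtain L where "J \<subseteq> L" "L \<subseteq> I" "\<psi> L = K" using surj[of K] K by auto
  then show psiJ: "\<psi> J = K" using \<psi>(2)[of J L] in_range[of J] J by auto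
  show "\<exists>k\<in>I - K. \<psi> (J \<union> {i}) = K \<union> {k}" if i: "i \<in> I - J"
  proof -
    have Ji: "J \<subseteq> J \<union> {i}" "J \<union> {i} \<subseteq> I" using i J by auto
    have "\<not> \<psi> (J \<union> {i}) \<subseteq> \<psi> J" using \<psi>(2)[OF Ji subset_refl J] i by auto
    then obtain k where k: "k \<in> \<psi> (J \<union> {i})" "k \<notin> K" unfolding psiJ by blast
    then have kI: "k \<in> I" using in_range[OF Ji] by blast
    then obtain L where L: "J \<subseteq> L" "L \<subseteq> I" "\<psi> L = K \<union> {k}" using surj[of "K \<union> {k}"] K by auto
    \<comment> \<open>The preimage \<open>L\<close> of \<open>K \<union> {k}\<close> is squeezed
      between \<open>J\<close> and \<open>J \<union> {i}\<close>.\<close>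
    have "\<psi> L \<subseteq> \<psi> (J \<union> {i})" using L k in_range[OF Ji] by auto
    then have "L \<subseteq> J \<union> {i}" using \<psi>(2)[OF L(1,2) Ji] by simp
    moreover have "L \<noteq> J" using L k psiJ by auto
    ultimately have "L = J \<union> {i}" using L by blast
    then show ?thesis using L k kI by blast
  qed
  show "\<exists>i\<in>I - J. \<psi> (J \<union> {i}) = K \<union> {k}" if k: "k \<in> I - K"
  proof -
    obtain L where L: "J \<subseteq> L" "L \<subseteq> I" "\<psi> L = K \<union> {k}" using surj[of "K \<union> {k}"] K k by auto
    have "L \<noteq> J" using L k psiJ by auto
    then obtain i where i: "i \<in> L" "i \<notin> J" using L by blast
    have Ji: "J \<subseteq> J \<union> {i}" "J \<union> {i} \<subseteq> I" using i J L by auto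
    have "\<psi> (J \<union> {i}) \<subseteq> K \<union> {k}" using \<psi>(2)[OF Ji L(1,2)] L i by auto
    moreover have "\<not> \<psi> (J \<union> {i}) \<subseteq> K" using \<psi>(2)[OF Ji subset_refl J] psiJ i by auto
    ultimately have "\<psi> (J \<union> {i}) = K \<union> {k}" using in_range[OF Ji] by blast
    then show ?thesis using i L by blast
  qed
qed

lemma type_step_surj: "k \<in> I - K \<Longrightarrow> \<exists>i. (i, k) \<in> type_step"
proof -
  assume k: "k \<in> I - K"
  obtain \<psi> where \<psi>: "bij_betw \<psi> {L. J \<subseteq> L \<and> L \<subseteq> I} {M. K \<subseteq> M \<and> M \<subseteq> I}"
    "\<And>L M. J \<subseteq> L \<Longrightarrow> L \<subseteq> I \<Longrightarrow> J \<subseteq> M \<Longrightarrow> M \<subseteq> I \<Longrightarrow> \<psi> L \<subseteq> \<psi> M \<longleftrightarrow> L \<subseteq> M"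
    "\<And>L. J \<subseteq> L \<Longrightarrow> L \<subseteq> I \<Longrightarrow> \<phi> ` par L = par (\<psi> L)"
    by (rule lattice_iso) (rule that)
  obtain i where "i \<in> I - J" "\<psi> (J \<union> {i}) = K \<union> {k}" using atoms(3)[OF \<psi>(1,2) k] by blast
  moreover from this have "\<phi> ` par (J \<union> {i}) = par (K \<union> {k})" using \<psi>(3)[of "J \<union> {i}"] J by auto
  ultimately show ?thesis using k by (auto simp: type_step_def)
qed

text \<open>It is shown that \<psi> takes \<open>s \<union> J\<close> to
  \<open>s \<union> K\<close>: types matched by \<open>atoms\<close> are equivalent, so
  \<open>s\<close> contains both or neither.\<close>

lemma class_closed:
  assumes s: "s \<in> I // E" shows "closed s"
proof -
  obtain \<psi> where \<psi>: "bij_betw \<psi> {L. J \<subseteq> L \<and> L \<subseteq> I} {M. K \<subseteq> M \<and> M \<subseteq> I}"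
    "\<And>L M. J \<subseteq> L \<Longrightarrow> L \<subseteq> I \<Longrightarrow> J \<subseteq> M \<Longrightarrow> M \<subseteq> I \<Longrightarrow> \<psi> L \<subseteq> \<psi> M \<longleftrightarrow> L \<subseteq> M"
    "\<And>L. J \<subseteq> L \<Longrightarrow> L \<subseteq> I \<Longrightarrow> \<phi> ` par L = par (\<psi> L)"
    by (rule lattice_iso) (rule that)
  have type_step: "(i, k) \<in> type_step" if "i \<in> I - J" "k \<in> I - K" "\<psi> (J \<union> {i}) = K \<union> {k}" for i k
    using \<psi>(3)[of "J \<union> {i}"] that J by (auto simp: type_step_def)
  have sI: "s \<subseteq> I" using class_subset s .
  have sJ: "J \<subseteq> s \<union> J" "s \<union> J \<subseteq> I" using sI J by auto
  have "\<psi> (s \<union> J) = s \<union> K"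
  proof
    \<comment> \<open>In terms of the preimage \<open>X\<close> of \<open>s \<union> K\<close> the
      inclusion reads \<open>s \<union> J \<subseteq> X\<close>.\<close>
    obtain X where X: "J \<subseteq> X" "X \<subseteq> I" "\<psi> X = s \<union> K"
    proof -
      have "s \<union> K \<in> \<psi> ` {L. J \<subseteq> L \<and> L \<subseteq> I}" using bij_betw_imp_surj_on[OF \<psi>(1)] sI K by auto
      then show thesis using that by blast
    qed
    have "i \<in> X" if i: "i \<in> s" "i \<notin> J" for i
    proof -
      have iI: "i \<in> I - J" using i sI by auto
      obtain k where k: "k \<in> I - K" "\<psi> (J \<union> {i}) = K \<union> {k}" using atoms(2)[OF \<psi>(1,2) iI] by blast
      then have "k \<in> s" using class_step[OF s type_step[OF iI]] i by blast
      then have "\<psi> (J \<union> {i}) \<subseteq> \<psi> X" using k X by auto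
      then show ?thesis using \<psi>(2)[of "J \<union> {i}" X] X J iI by auto
    qed
    then have "s \<union> J \<subseteq> X" using X by blast
    then show "\<psi> (s \<union> J) \<subseteq> s \<union> K" using \<psi>(2)[OF sJ X(1,2)] X by simp
    show "s \<union> K \<subseteq> \<psi> (s \<union> J)"
    proof
      fix k assume k: "k \<in> s \<union> K"
      show "k \<in> \<psi> (s \<union> J)"
      proof (cases "k \<in> K")
        case True
        then show ?thesis using \<psi>(2)[OF subset_refl J sJ] sJ atoms(1)[OF \<psi>(1,2)] by blast
      next
        case False
        then have kI: "k \<in> I - K" using k sI by auto
        obtain i where i: "i \<in> I - J" "\<psi> (J \<union> {i}) = K \<union> {k}" using atoms(3)[OF \<psi>(1,2) kI] by blast
        then have "i \<in> s" using class_step[OF s type_step[OF i(1) kI i(2)]] k False by auto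
        then have "\<psi> (J \<union> {i}) \<subseteq> \<psi> (s \<union> J)" using \<psi>(2)[of "J \<union> {i}" "s \<union> J"] sJ i J by auto
        then show ?thesis using i by auto
      qed
    qed
  qed
  then show ?thesis using \<psi>(3)[OF sJ] sI by (simp add: closed_def)
qed

text \<open>A type \<open>k\<close> of the class inside \<open>K\<close> is not in
  \<open>J - K\<close>. If \<open>k\<close> is outside \<open>K\<close>, its partner under
  \<open>type_step\<close> belongs to the class and is outside \<open>J\<close>.\<close>

lemma class_not_subset: assumes "s \<in> I // E" obtains i where "i \<in> s" "i \<in> I" "i \<notin> J - K"
proof -
  obtain k where k: "k \<in> s" using in_quotient_imp_non_empty[OF equiv_E assms] by blast
  have kI: "k \<in> I" using class_subset[OF assms] k by blast
  show thesis
  proof (cases "k \<in> K")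
    case True
    then show ?thesis using that k kI by blast
  next
    case False
    then obtain i where i: "(i, k) \<in> type_step" using type_step_surj kI by blast
    then have "i \<in> s" using class_step[OF assms i] k by blast
    moreover have "i \<in> I" "i \<notin> J - K" using i by (auto simp: type_step_def)
    ultimately show ?thesis using that by blast
  qed
qed

section \<open>The coset system of the HNN-extension and its Helly property\<close>

abbreviation T where "T \<equiv> hnn_types A I H J K \<phi>"
abbreviation HH where "HH \<equiv> hnn_subgroup A H J K \<phi>"
abbreviation F where "F \<equiv> J - K"

lemma HH_Some: "HH (Some s) = gen (par s)"
  by (simp add: hnn_subgroup_def gen_def p_True)

lemma HH_None: "HH None = base ` par F"
  by (simp add: hnn_subgroup_def p_True)

lemma F_subset: "F \<subseteq> I"
  using J by blast

lemma base_par_subgroup: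
  assumes "X \<subseteq> I" shows "subgroup (base ` par X) G"
proof
  note P = par_subgroup[OF assms]
  show "base ` par X \<subseteq> carrier G" using par_carrier by auto
  show "x \<otimes>\<^bsub>G\<^esub> y \<in> base ` par X" if "x \<in> base ` par X" "y \<in> base ` par X" for x y
    using that subgroup.m_closed[OF P] by (auto simp: base_mult[symmetric])
  show "\<one>\<^bsub>G\<^esub> \<in> base ` par X" using subgroup.one_closed[OF P] base_one by (metis image_eqI)
  show "inv\<^bsub>G\<^esub> x \<in> base ` par X" if "x \<in> base ` par X" for x
    using that subgroup.m_inv_closed[OF P] by (auto simp: base_inv[symmetric])
qed

lemma gen_par_subgroup: "subgroup (gen (par X)) G"
  by (rule gen_subgroup) (auto simp: parabolic_def)

sublocale X: coset_data G T HH
proof (intro coset_data.intro coset_data_axioms.intro)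
  show "group G" by (rule group_G)
  show "subgroup (HH i) G" for i
    using gen_par_subgroup base_par_subgroup[OF F_subset] by (cases i) (simp_all add: HH_Some HH_None)
qed

lemma base_mem_gen: "closed X \<Longrightarrow> a \<in> carrier A \<Longrightarrow> base a \<in> gen (par X) \<longleftrightarrow> a \<in> par X"
  using gen_Int_base[OF closed_stable] gen_base by blast

lemma gen_iff: "g \<in> carrier G \<Longrightarrow> x \<in> g <#\<^bsub>G\<^esub> gen (par X) \<longleftrightarrow> x \<in> carrier G \<and> inv\<^bsub>G\<^esub> g \<otimes>\<^bsub>G\<^esub> x \<in> gen (par X)"
  by (rule G.mem_l_coset_iff[OF gen_par_subgroup])

text \<open>Both cosets contain an element over the root, namely \<open>base a\<close> or
  \<open>base b\<close>. The common element from \<open>meet_nearest\<close> is nearest in one of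
  them, so it lies over the root and comes from the base.\<close>

lemma meet_in_base:
  assumes X: "closed X" "a \<in> carrier A" and Y: "closed Y" "b \<in> carrier A"
    and meet: "(base a <#\<^bsub>G\<^esub> gen (par X)) \<inter> (base b <#\<^bsub>G\<^esub> gen (par Y)) \<noteq> {}"
  shows "(a <# par X) \<inter> (b <# par Y) \<noteq> {}"
proof -
  have comp: "compatible (par X) (par Y)" using X Y compatible_par by (simp add: closed_def)
  obtain x where x: "x \<in> base a <#\<^bsub>G\<^esub> gen (par X)" "x \<in> base b <#\<^bsub>G\<^esub> gen (par Y)"
    and min: "(\<forall>u\<in>gen (par X). length (vertex x) \<le> length (vertex (x \<otimes>\<^bsub>G\<^esub> u))) \<or>
     (\<forall>u\<in>gen (par Y). length (vertex x) \<le> length (vertex (x \<otimes>\<^bsub>G\<^esub> u)))"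
    using meet_nearest[OF closed_stable[OF X(1)] closed_stable[OF Y(1)] comp
        base_carrier[OF X(2)] base_carrier[OF Y(2)] meet] by blast
  have xc: "x \<in> carrier G" using x(1) X(2) by (simp add: gen_iff)
  have z: "vertex (x \<otimes>\<^bsub>G\<^esub> (inv\<^bsub>G\<^esub> x \<otimes>\<^bsub>G\<^esub> base c)) = []" if "c \<in> carrier A" for c
    using that xc vertex_base[of "\<one>\<^bsub>G\<^esub>" c] by (simp add: G.m_assoc[symmetric] vertex_one)
  have inv_mem: "inv\<^bsub>G\<^esub> x \<otimes>\<^bsub>G\<^esub> base c \<in> gen (par Z)" if "c \<in> carrier A" "x \<in> base c <#\<^bsub>G\<^esub> gen (par Z)" for c Z
  proof -
    have "inv\<^bsub>G\<^esub> (inv\<^bsub>G\<^esub> (base c) \<otimes>\<^bsub>G\<^esub> x) \<in> gen (par Z)"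
      using that by (intro subgroup.m_inv_closed[OF gen_par_subgroup]) (simp add: gen_iff)
    then show ?thesis using that xc by (simp add: G.inv_mult_group)
  qed
  have "vertex x = []"
    using min z[OF X(2)] z[OF Y(2)] inv_mem[OF X(2) x(1)] inv_mem[OF Y(2) x(2)] by fastforce
  then obtain c where c: "c \<in> carrier A" "x = \<one>\<^bsub>G\<^esub> \<otimes>\<^bsub>G\<^esub> base c"
    using vertex_eqD[of "\<one>\<^bsub>G\<^esub>" x] xc vertex_one by auto
  have "c \<in> d <# par Z" if "closed Z" "d \<in> carrier A" "x \<in> base d <#\<^bsub>G\<^esub> gen (par Z)" for d Z
  proof -
    have "base (inv d \<otimes> c) \<in> gen (par Z)" using that c by (simp add: gen_iff base_mult base_inv)
    then have "inv d \<otimes> c \<in> par Z" using base_mem_gen that c by simp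
    then show ?thesis using that c by (simp add: mem_l_coset_iff[OF par_subgroup] closed_def)
  qed
  then show ?thesis using X Y x by blast
qed

text \<open>Translation by the inverse of \<open>y\<close> moves the vertex to the root. There
  \<open>meet_in_base\<close> yields pairwise meeting cosets of parabolic subgroups, to which the
  Helly property of the original system applies.\<close>

lemma helly_at_vertex:
  assumes cl: "\<And>s. s \<in> U \<Longrightarrow> closed s" and g: "\<And>s. s \<in> U \<Longrightarrow> g s \<in> carrier G"
    and y: "y \<in> carrier G" and X: "X \<subseteq> I"
    and a: "\<And>s. s \<in> U \<Longrightarrow> \<exists>a\<in>par X. y \<otimes>\<^bsub>G\<^esub> base a \<in> g s <#\<^bsub>G\<^esub> gen (par s)"
    and meet: "\<And>s s'. s \<in> U \<Longrightarrow> s' \<in> U \<Longrightarrow>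
      (g s <#\<^bsub>G\<^esub> gen (par s)) \<inter> (g s' <#\<^bsub>G\<^esub> gen (par s')) \<noteq> {}"
  shows "\<exists>c\<in>par X. \<forall>s\<in>U. y \<otimes>\<^bsub>G\<^esub> base c \<in> g s <#\<^bsub>G\<^esub> gen (par s)"
proof -
  obtain a where a: "\<And>s. s \<in> U \<Longrightarrow> a s \<in> par X"
      "\<And>s. s \<in> U \<Longrightarrow> y \<otimes>\<^bsub>G\<^esub> base (a s) \<in> g s <#\<^bsub>G\<^esub> gen (par s)"
    using a by metis
  have ac: "a s \<in> carrier A" if "s \<in> U" for s using a(1)[OF that] by simp
  have sI: "s \<subseteq> I" if "s \<in> U" for s using cl[OF that] by (simp add: closed_def)
  have iff: "z \<in> g s <#\<^bsub>G\<^esub> gen (par s) \<longleftrightarrow>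
      z \<in> carrier G \<and> inv\<^bsub>G\<^esub> (base (a s)) \<otimes>\<^bsub>G\<^esub> (inv\<^bsub>G\<^esub> y \<otimes>\<^bsub>G\<^esub> z) \<in> gen (par s)" if s: "s \<in> U" for s z
  proof -
    have "g s <#\<^bsub>G\<^esub> gen (par s) = (y \<otimes>\<^bsub>G\<^esub> base (a s)) <#\<^bsub>G\<^esub> gen (par s)"
      by (rule G.l_repr_independence[OF a(2)[OF s] g[OF s] gen_par_subgroup])
    then show ?thesis using y ac[OF s] by (auto simp: gen_iff G.inv_mult_group G.m_assoc)
  qed
  note piff = mem_l_coset_iff[OF par_subgroup]
  have pair: "(a s <# par s) \<inter> (a s' <# par s') \<noteq> {}" if s: "s \<in> U" "s' \<in> U" for s s'
  proof -
    obtain z where "z \<in> g s <#\<^bsub>G\<^esub> gen (par s)" "z \<in> g s' <#\<^bsub>G\<^esub> gen (par s')" using meet s by blast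
    then have "inv\<^bsub>G\<^esub> y \<otimes>\<^bsub>G\<^esub> z \<in> base (a s) <#\<^bsub>G\<^esub> gen (par s)" "inv\<^bsub>G\<^esub> y \<otimes>\<^bsub>G\<^esub> z \<in> base (a s') <#\<^bsub>G\<^esub> gen (par s')"
      using iff s ac y by (simp_all add: gen_iff)
    then show ?thesis using meet_in_base[OF cl ac cl ac] s by blast
  qed
  have X1: "b \<in> \<one> <# par X" if "b \<in> par X" for b
    using that X by (simp add: piff)
  have self: "a s \<in> a s <# par s" if "s \<in> U" for s
    using that ac sI subgroup.one_closed[OF par_subgroup] by (simp add: piff)
  \<comment> \<open>Adding \<open>par X\<close> itself to the family forces the common element into
    \<open>par X\<close>.\<close>
  define P where "P = insert (X, \<one>) ((\<lambda>s. (s, a s)) ` U)"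
  have "P \<subseteq> Pow I \<times> carrier A" using X sI ac by (auto simp: P_def)
  moreover have "(b <# par V) \<inter> (d <# par W) \<noteq> {}" if "(V, b) \<in> P" "(W, d) \<in> P" for V b W d
  proof -
    have mem: "V = X \<and> b = \<one> \<or> V \<in> U \<and> b = a V" if "(V, b) \<in> P" for V b
      using that by (auto simp: P_def)
    have "(\<one> <# par X) \<inter> (\<one> <# par X) \<noteq> {}"
      using X1[OF subgroup.one_closed[OF par_subgroup[OF X]]] by blast
    moreover have "(\<one> <# par X) \<inter> (a s <# par s) \<noteq> {}" "(a s <# par s) \<inter> (\<one> <# par X) \<noteq> {}" if "s \<in> U" for s
      using X1[OF a(1)[OF that]] self[OF that] by blast+
    ultimately show ?thesis using mem[OF that(1)] mem[OF that(2)] pair by (elim disjE conjE) simp_all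
  qed
  ultimately obtain c where c: "c \<in> carrier A" "\<And>V b. (V, b) \<in> P \<Longrightarrow> c \<in> b <# par V"
    using helly_par[OF hel, of P] by blast
  have "c \<in> \<one> <# par X" using c(2) by (simp add: P_def)
  then have "c \<in> par X" using X c(1) by (simp add: piff)
  moreover have "y \<otimes>\<^bsub>G\<^esub> base c \<in> g s <#\<^bsub>G\<^esub> gen (par s)" if s: "s \<in> U" for s
  proof -
    have "c \<in> a s <# par s" using c(2) s by (simp add: P_def)
    then have "inv (a s) \<otimes> c \<in> par s" using ac s sI by (simp add: piff)
    then have "base (inv (a s) \<otimes> c) \<in> gen (par s)" by (rule gen_base)
    then show ?thesis using iff[OF s] ac[OF s] c(1) y by (simp add: base_mult base_inv G.m_assoc[symmetric])
  qed
  ultimately show ?thesis by blast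
qed

text \<open>Helly property of subtrees: among the subtrees of a pairwise intersecting family, take one
  whose vertex nearest to the root is as far as possible from the root; that vertex lies in all of
  them.\<close>

lemma common_vertex:
  assumes fin: "finite U" and cl: "\<And>s. s \<in> U \<Longrightarrow> closed s"
    and g: "\<And>s. s \<in> U \<Longrightarrow> g s \<in> carrier G"
    and meet: "\<And>s s'. s \<in> U \<Longrightarrow> s' \<in> U \<Longrightarrow>
      (g s <#\<^bsub>G\<^esub> gen (par s)) \<inter> (g s' <#\<^bsub>G\<^esub> gen (par s')) \<noteq> {}"
  shows "\<exists>y\<in>carrier G. \<forall>s\<in>U. \<exists>a\<in>carrier A. y \<otimes>\<^bsub>G\<^esub> base a \<in> g s <#\<^bsub>G\<^esub> gen (par s)"
proof (cases "U = {}")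
  case True
  then show ?thesis using G.one_closed by blast
next
  case False
  let ?Y = "\<lambda>s. g s <#\<^bsub>G\<^esub> gen (par s)"
  have "\<exists>y. y \<in> ?Y s \<and> (\<forall>z. z \<in> ?Y s \<longrightarrow> length (vertex y) \<le> length (vertex z))" if s: "s \<in> U" for s
  proof -
    obtain z where "z \<in> ?Y s" using meet[OF s s] by blast
    then show ?thesis using ex_has_least_nat[of "\<lambda>z. z \<in> ?Y s" z "\<lambda>z. length (vertex z)"] by blast
  qed
  then obtain y where y: "\<And>s. s \<in> U \<Longrightarrow> y s \<in> ?Y s"
      "\<And>s z. s \<in> U \<Longrightarrow> z \<in> ?Y s \<Longrightarrow> length (vertex (y s)) \<le> length (vertex z)"
    by metis
  have yc: "y s \<in> carrier G" if "s \<in> U" for s using y(1)[OF that] g[OF that] by (simp add: gen_iff)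
  have Y: "x \<in> ?Y s \<longleftrightarrow> x \<in> carrier G \<and> inv\<^bsub>G\<^esub> z \<otimes>\<^bsub>G\<^esub> x \<in> gen (par s)" if "s \<in> U" "z \<in> ?Y s" for s x z
  proof -
    have "z \<in> carrier G" using that g by (simp add: gen_iff)
    then show ?thesis
      using G.l_repr_independence[OF that(2) g[OF that(1)] gen_par_subgroup] by (simp add: gen_iff)
  qed
  \<comment> \<open>\<open>t\<close> is a member whose nearest vertex is farthest from the root;
    this vertex is shown to lie in every other subtree.\<close>
  define m where "m = Max ((\<lambda>s. length (vertex (y s))) ` U)"
  have "m \<in> (\<lambda>s. length (vertex (y s))) ` U" unfolding m_def using fin False by (intro Max_in) auto
  then obtain t where t: "t \<in> U" "m = length (vertex (y t))" by blast
  have max: "length (vertex (y s)) \<le> length (vertex (y t))" if "s \<in> U" for s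
    using Max_ge[of "(\<lambda>s. length (vertex (y s))) ` U"] fin that t(2) unfolding m_def by auto
  have "\<exists>a\<in>carrier A. y t \<otimes>\<^bsub>G\<^esub> base a \<in> ?Y s" if s: "s \<in> U" for s
  proof -
    have comp: "compatible (par t) (par s)"
      using cl[OF s] cl[OF t(1)] compatible_par by (simp add: closed_def)
    obtain x where x: "x \<in> ?Y t" "x \<in> ?Y s"
      and min: "(\<forall>u\<in>gen (par t). length (vertex x) \<le> length (vertex (x \<otimes>\<^bsub>G\<^esub> u))) \<or>
        (\<forall>u\<in>gen (par s). length (vertex x) \<le> length (vertex (x \<otimes>\<^bsub>G\<^esub> u)))"
      using meet_nearest[OF closed_stable[OF cl[OF t(1)]] closed_stable[OF cl[OF s]] comp
          g[OF t(1)] g[OF s] meet[OF t(1) s]] by blast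
    have xc: "x \<in> carrier G" using x(1) g[OF t(1)] by (simp add: gen_iff)
    have cancel: "x \<otimes>\<^bsub>G\<^esub> (inv\<^bsub>G\<^esub> x \<otimes>\<^bsub>G\<^esub> z) = z" if "z \<in> carrier G" for z
      using that xc by (simp add: G.m_assoc[symmetric])
    \<comment> \<open>\<open>x\<close> is nearest in the subtree of \<open>t\<close> or of
      \<open>s\<close>, so it is no farther from the root than \<open>y t\<close> or
      \<open>y s\<close>, and \<open>y t\<close> is the farther of these two.\<close>
    have "length (vertex x) \<le> length (vertex (y t))"
      using min
    proof
      assume "\<forall>u\<in>gen (par t). length (vertex x) \<le> length (vertex (x \<otimes>\<^bsub>G\<^esub> u))"
      then have "length (vertex x) \<le> length (vertex (x \<otimes>\<^bsub>G\<^esub> (inv\<^bsub>G\<^esub> x \<otimes>\<^bsub>G\<^esub> y t)))"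
        using Y[OF t(1) x(1), of "y t"] y(1)[OF t(1)] by blast
      then show ?thesis using cancel yc[OF t(1)] by simp
    next
      assume "\<forall>u\<in>gen (par s). length (vertex x) \<le> length (vertex (x \<otimes>\<^bsub>G\<^esub> u))"
      then have "length (vertex x) \<le> length (vertex (x \<otimes>\<^bsub>G\<^esub> (inv\<^bsub>G\<^esub> x \<otimes>\<^bsub>G\<^esub> y s)))"
        using Y[OF s x(2), of "y s"] y(1)[OF s] by blast
      then show ?thesis using cancel yc[OF s] max[OF s] by simp
    qed
    moreover have "y t \<otimes>\<^bsub>G\<^esub> (inv\<^bsub>G\<^esub> (y t) \<otimes>\<^bsub>G\<^esub> x) = x"
      using yc[OF t(1)] xc by (simp add: G.m_assoc[symmetric])
    moreover have "\<forall>u\<in>gen (par t). length (vertex (y t)) \<le> length (vertex (y t \<otimes>\<^bsub>G\<^esub> u))"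
    proof
      fix u assume u: "u \<in> gen (par t)"
      then have uc: "u \<in> carrier G" using subgroup.mem_carrier[OF gen_par_subgroup] by blast
      have "y t \<otimes>\<^bsub>G\<^esub> u \<in> ?Y t"
        using Y[OF t(1) y(1)[OF t(1)], of "y t \<otimes>\<^bsub>G\<^esub> u"] yc[OF t(1)] u uc by (simp add: G.m_assoc[symmetric])
      then show "length (vertex (y t)) \<le> length (vertex (y t \<otimes>\<^bsub>G\<^esub> u))" using y(2)[OF t(1)] by blast
    qed
    moreover have "inv\<^bsub>G\<^esub> (y t) \<otimes>\<^bsub>G\<^esub> x \<in> gen (par t)" using Y[OF t(1) y(1)[OF t(1)], of x] x(1) by blast
    moreover have "subgroup (par t) A" using par_subgroup cl[OF t(1)] by (simp add: closed_def)
    ultimately have "vertex x = vertex (y t)"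
      using nearest_unique[of "par t" "y t" "inv\<^bsub>G\<^esub> (y t) \<otimes>\<^bsub>G\<^esub> x"] yc[OF t(1)] by simp
    then obtain a where "a \<in> carrier A" "x = y t \<otimes>\<^bsub>G\<^esub> base a"
      using vertex_eqD[OF yc[OF t(1)] xc] by metis
    then show ?thesis using x(2) by blast
  qed
  then show ?thesis using yc[OF t(1)] by blast
qed

text \<open>A coset of type \<open>None\<close> fixes the vertex and requires a common element from
  \<open>par F\<close>. Without such a coset, \<open>common_vertex\<close> supplies the vertex and
  every element over it is allowed.\<close>

lemma helly_hnn: "helly G T HH"
proof (rule X.hellyI)
  fix L g assume L: "L \<subseteq> T" and g: "g \<in> L \<rightarrow> carrier G"
    and meet: "\<And>i j. i \<in> L \<Longrightarrow> j \<in> L \<Longrightarrow> (g i <#\<^bsub>G\<^esub> HH i) \<inter> (g j <#\<^bsub>G\<^esub> HH j) \<noteq> {}"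
  define U where "U = {s. Some s \<in> L}"
  have UE: "U \<subseteq> I // E" using L by (auto simp: U_def hnn_types_def)
  have U: "finite U" "\<And>s. s \<in> U \<Longrightarrow> closed s"
    using UE finite_classes finite_subset class_closed by blast+
  have gU: "g (Some s) \<in> carrier G" if "s \<in> U" for s using that g by (auto simp: U_def)
  have meetU: "(g (Some s) <#\<^bsub>G\<^esub> gen (par s)) \<inter> (g (Some s') <#\<^bsub>G\<^esub> gen (par s')) \<noteq> {}"
    if "s \<in> U" "s' \<in> U" for s s'
    using meet[of "Some s" "Some s'"] that by (simp add: U_def HH_Some)
  show "\<exists>x\<in>carrier G. \<forall>i\<in>L. x \<in> g i <#\<^bsub>G\<^esub> HH i"
  proof (cases "None \<in> L")
    case True
    have gN: "g None \<in> carrier G" using g True by blast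
    have ex: "\<exists>a\<in>par F. g None \<otimes>\<^bsub>G\<^esub> base a \<in> g (Some s) <#\<^bsub>G\<^esub> gen (par s)" if s: "s \<in> U" for s
    proof -
      have "(g None <#\<^bsub>G\<^esub> HH None) \<inter> (g (Some s) <#\<^bsub>G\<^esub> HH (Some s)) \<noteq> {}"
        using meet True s by (simp add: U_def)
      then show ?thesis unfolding HH_None HH_Some by (auto simp: l_coset_def)
    qed
    then obtain c where c: "c \<in> par F" "\<forall>s\<in>U. g None \<otimes>\<^bsub>G\<^esub> base c \<in> g (Some s) <#\<^bsub>G\<^esub> gen (par s)"
      using helly_at_vertex[of U "\<lambda>s. g (Some s)", OF U(2) gU gN F_subset ex meetU] by blast
    have "g None \<otimes>\<^bsub>G\<^esub> base c \<in> g i <#\<^bsub>G\<^esub> HH i" if i: "i \<in> L" for i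
    proof (cases i)
      case None
      then show ?thesis using c(1) by (auto simp: HH_None l_coset_def)
    next
      case (Some s)
      then show ?thesis using c(2) i by (simp add: HH_Some U_def)
    qed
    moreover have "g None \<otimes>\<^bsub>G\<^esub> base c \<in> carrier G" using gN c(1) by simp
    ultimately show ?thesis by blast
  next
    case False
    obtain y where y: "y \<in> carrier G"
        "\<forall>s\<in>U. \<exists>a\<in>carrier A. y \<otimes>\<^bsub>G\<^esub> base a \<in> g (Some s) <#\<^bsub>G\<^esub> gen (par s)"
      using common_vertex[of U "\<lambda>s. g (Some s)", OF U gU meetU] by blast
    \<comment> \<open>The absence of a condition at the vertex is the case \<open>X = {}\<close> of
      \<open>helly_at_vertex\<close>.\<close>
    have "carrier A = par {}" by (simp add: parabolic_def)
    then have ex: "\<exists>a\<in>par {}. y \<otimes>\<^bsub>G\<^esub> base a \<in> g (Some s) <#\<^bsub>G\<^esub> gen (par s)" if "s \<in> U" for s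
      using y(2) that by simp
    obtain c where c: "c \<in> par {}" "\<forall>s\<in>U. y \<otimes>\<^bsub>G\<^esub> base c \<in> g (Some s) <#\<^bsub>G\<^esub> gen (par s)"
      using helly_at_vertex[of U "\<lambda>s. g (Some s)", OF U(2) gU y(1) empty_subsetI ex meetU] by blast
    have "y \<otimes>\<^bsub>G\<^esub> base c \<in> g i <#\<^bsub>G\<^esub> HH i" if i: "i \<in> L" for i
    proof -
      obtain s where "i = Some s" using False i by (cases i) auto
      then show ?thesis using c(2) i by (simp add: HH_Some U_def)
    qed
    moreover have "y \<otimes>\<^bsub>G\<^esub> base c \<in> carrier G" using y c(1) by simp
    ultimately show ?thesis by blast
  qed
qed

section \<open>Residual connectedness and firmness\<close>

text \<open>The stable letter moves the root of the tree, whereas the base fixes it.\<close>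

lemma stab_not_base: assumes "a \<in> carrier A" shows "stab e \<noteq> base a"
proof
  assume "stab e = base a"
  moreover have "vertex (base a) = []"
    using vertex_base[of "\<one>\<^bsub>G\<^esub>" a] assms by (simp add: vertex_one)
  moreover have "vertex (stab e) \<noteq> []"
    using nf_mult_stab[of "\<one>\<^bsub>G\<^esub>" "{}" e] by (simp add: nf_one Let_def)
  ultimately show False by simp
qed

section \<open>Parabolic subgroups of the HNN-extension\<close>

definition support :: "'i set option set \<Rightarrow> 'i set" where
  "support L = \<Union>{s. Some s \<in> L}"

lemma classes_of:
  assumes "L \<subseteq> T" shows "finite {s. Some s \<in> L}" "\<And>s. Some s \<in> L \<Longrightarrow> s \<in> I // E"
  using assms finite_subset[OF _ finite_classes, of "{s. Some s \<in> L}"] by (auto simp: hnn_types_def)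

lemma closed_union: "L \<subseteq> T \<Longrightarrow> closed (support L)"
  unfolding support_def using classes_of class_closed by (intro closed_Union) auto

lemma support_subset: "L \<subseteq> T \<Longrightarrow> support L \<subseteq> I"
  using closed_union by (simp add: closed_def)

lemma support_insert_Some: "support (insert (Some s) L) = s \<union> support L"
  by (auto simp: support_def)

lemma support_insert_None: "support (insert None L) = support L"
  by (auto simp: support_def)

lemma par_hnn_without:
  assumes "L \<subseteq> T" "None \<notin> L" shows "X.par L = gen (par (support L))"
proof -
  define U where "U = {s. Some s \<in> L}"
  have L: "L = Some ` U"
  proof (intro equalityI subsetI)
    fix i assume "i \<in> L"
    then show "i \<in> Some ` U" using assms(2) by (cases i) (auto simp: U_def)
  qed (auto simp: U_def)
  have "(\<Inter>i\<in>L. HH i) = (\<Inter>s\<in>U. gen (par s))" unfolding L by (simp add: HH_Some)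
  then have "X.par L = carrier G \<inter> (\<Inter>s\<in>{s. Some s \<in> L}. gen (par s))"
    by (simp add: parabolic_def[of G] U_def)
  also have "\<dots> = gen (par (support L))"
    unfolding support_def using classes_of[OF assms(1)] class_closed by (intro gen_par_Union) auto
  finally show ?thesis .
qed

text \<open>Intersecting with the base reduces \<open>gen (par (support L))\<close> to the base
  image of \<open>par (support L)\<close>, by \<open>base_mem_gen\<close>.\<close>

lemma par_hnn_with:
  assumes "L \<subseteq> T" "None \<in> L" shows "X.par L = base ` par (support L \<union> F)"
proof -
  have L: "L - {None} \<subseteq> T" "None \<notin> L - {None}" "support (L - {None}) = support L"
    using assms by (auto simp: support_def)
  have "X.par L = X.par (L - {None}) \<inter> base ` par F"
    using assms(2) by (auto simp: parabolic_def[of G] HH_None)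
  also have "\<dots> = gen (par (support L)) \<inter> base ` par F" using par_hnn_without[OF L(1,2)] L(3) by simp
  also have "\<dots> = base ` par (support L \<union> F)"
    using base_mem_gen[OF closed_union[OF assms(1)]] by (auto simp: par_Un)
  finally show ?thesis .
qed

lemma disjoint_classes: "s \<in> I // E \<Longrightarrow> s' \<in> I // E \<Longrightarrow> s \<noteq> s' \<Longrightarrow> s \<inter> s' = {}"
  using quotient_disj[OF equiv_E, of s s'] by simp

text \<open>Pulling \<open>N\<close> back to the base group makes \<open>par_Int_le\<close> for the
  original system available.\<close>

lemma base_preimage:
  assumes "subgroup N G" shows "subgroup {a \<in> carrier A. base a \<in> N} A"
proof
  show "\<one> \<in> {a \<in> carrier A. base a \<in> N}" using subgroup.one_closed[OF assms] by (simp add: base_one)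
  show "x \<otimes> y \<in> {a \<in> carrier A. base a \<in> N}"
    if "x \<in> {a \<in> carrier A. base a \<in> N}" "y \<in> {a \<in> carrier A. base a \<in> N}" for x y
    using that subgroup.m_closed[OF assms] by (simp add: base_mult)
  show "inv x \<in> {a \<in> carrier A. base a \<in> N}" if "x \<in> {a \<in> carrier A. base a \<in> N}" for x
    using that subgroup.m_inv_closed[OF assms] by (simp add: base_inv)
qed auto

lemma hnn_residually_connected:
  assumes rc: "residually_connected S" shows "residually_connected X.S"
proof (rule X.generate_imp_residually_connected[OF helly_hnn])
  fix L assume L: "L \<subseteq> T" and c: "card (T - L) \<ge> 2"
  define N where "N = generate G (\<Union>i\<in>T - L. X.par (insert i L))"
  have N: "subgroup N G" unfolding N_def
    by (rule G.generate_is_subgroup) (auto simp: parabolic_def[of G])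
  define N' where "N' = {a \<in> carrier A. base a \<in> N}"
  have N': "subgroup N' A" unfolding N'_def using base_preimage[OF N] .
  have inN: "X.par (insert i L) \<subseteq> N" if "i \<in> T - L" for i
    unfolding N_def using that generate.incl[of _ "\<Union>i\<in>T - L. X.par (insert i L)" G] by blast
  have inN': "par Y \<subseteq> N'" if "base ` par Y \<subseteq> N" for Y using that by (auto simp: N'_def)
  have ins: "insert i L \<subseteq> T" if "i \<in> T - L" for i using that L by blast
  have two: "\<exists>i\<in>T - L. i \<noteq> j" for j
  proof (rule ccontr)
    assume "\<not> ?thesis"
    then have "T - L \<subseteq> {j}" by blast
    then have "card (T - L) \<le> card {j}" by (intro card_mono) auto
    then show False using c by simp
  qed
  have UL: "support L \<subseteq> I" using support_subset L .
  have "X.par L \<subseteq> N"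
  proof (cases "None \<in> L")
    case True
    \<comment> \<open>Two classes \<open>s\<close> and \<open>s'\<close> are missing from
      \<open>L\<close>. They are disjoint, so the type sets enlarged by them intersect in
      \<open>support L \<union> F\<close>.\<close>
    obtain i where i: "i \<in> T - L" "i \<noteq> None" using two by blast
    obtain j where j: "j \<in> T - L" "j \<noteq> i" using two by blast
    obtain s s' where s: "i = Some s" "j = Some s'" using i j True by (cases i; cases j) auto
    have ss: "s \<in> I // E" "s' \<in> I // E"
      using classes_of(2)[OF ins[OF i(1)], of s] classes_of(2)[OF ins[OF j(1)], of s'] s by auto
    have dis: "s \<inter> s' = {}" using disjoint_classes[OF ss] j s by auto
    have sub: "s \<union> support L \<union> F \<subseteq> I" "s' \<union> support L \<union> F \<subseteq> I"
      using class_subset ss UL F_subset by auto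
    have "base ` par (s \<union> support L \<union> F) \<subseteq> N" "base ` par (s' \<union> support L \<union> F) \<subseteq> N"
      using inN[OF i(1)] inN[OF j(1)] par_hnn_with[OF ins[OF i(1)]] par_hnn_with[OF ins[OF j(1)]] True s
      by (simp_all add: support_insert_Some)
    then have "par ((s \<union> support L \<union> F) \<inter> (s' \<union> support L \<union> F)) \<subseteq> N'"
      by (intro par_Int_le[OF hel rc finite_I N' sub] inN')
    moreover have "(s \<union> support L \<union> F) \<inter> (s' \<union> support L \<union> F) = support L \<union> F" using dis by blast
    ultimately have "par (support L \<union> F) \<subseteq> N'" by simp
    then show ?thesis using par_hnn_with[OF L True] by (auto simp: N'_def)
  next
    case False
    \<comment> \<open>Besides \<open>None\<close> some class is missing from \<open>L\<close>; its
      parabolic subgroup contributes the stable letter to \<open>N\<close>.\<close>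
    obtain i where i: "i \<in> T - L" "i \<noteq> None" using two by blast
    then obtain s where s: "i = Some s" by auto
    have "X.par (insert i L) = gen (par (support (insert i L)))"
      using par_hnn_without[OF ins[OF i(1)]] False s by simp
    then have t: "stab e \<in> N" for e using inN[OF i(1)] gen_stab by auto
    have None: "None \<in> T - L" using False by (simp add: hnn_types_def)
    have b: "base ` par (support L \<union> F) \<subseteq> N"
      using inN[OF None] par_hnn_with[OF ins[OF None]] by (simp add: support_insert_None)
    \<comment> \<open>Conjugation by the stable letter carries the part of
      \<open>par (support L \<union> F)\<close> lying in \<open>par J\<close> onto
      \<open>par (support L \<union> K)\<close>.\<close>
    have "base ` par (support L \<union> K) \<subseteq> N"
    proof
      fix x assume "x \<in> base ` par (support L \<union> K)"
      moreover have "\<phi> ` par (support L \<union> J) = par (support L \<union> K)"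
        using closed_union[OF L] by (simp add: closed_def)
      ultimately have "x \<in> base ` \<phi> ` par (support L \<union> J)" by simp
      then obtain a where a: "x = base (\<phi> a)" "a \<in> par (support L \<union> J)" by blast
      have aJ: "a \<in> C True" "a \<in> par (support L \<union> F)"
        using a(2) by (auto simp: p_True parabolic_def)
      have "stab False \<otimes>\<^bsub>G\<^esub> (base a \<otimes>\<^bsub>G\<^esub> stab True) = base (p True a)"
        using base_stab[OF aJ(1)] stab_not[of False] aJ by (simp add: G.m_assoc[symmetric])
      moreover have "stab False \<otimes>\<^bsub>G\<^esub> (base a \<otimes>\<^bsub>G\<^esub> stab True) \<in> N"
        using t b aJ(2) by (intro subgroup.m_closed[OF N]) auto
      ultimately show "x \<in> N" using a(1) by (simp add: p_True)
    qed
    then have "par ((support L \<union> F) \<inter> (support L \<union> K)) \<subseteq> N'"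
      using UL F_subset K b by (intro par_Int_le[OF hel rc finite_I N'] inN') auto
    moreover have "(support L \<union> F) \<inter> (support L \<union> K) = support L" by blast
    ultimately have "base ` par (support L) \<subseteq> N" by (auto simp: N'_def)
    then show ?thesis using gen_leI[OF N t[of True]] par_hnn_without[OF L False] by simp
  qed
  then show "X.par L \<subseteq> generate G (\<Union>i\<in>T - L. X.par (insert i L))" unfolding N_def .
qed

lemma hnn_firm:
  assumes "firm S" shows "firm X.S"
proof (rule X.not_subset_imp_firm[OF helly_hnn])
  show "finite T" using finite_classes by (simp add: hnn_types_def)
  fix i assume i: "i \<in> T"
  have L: "T - {i} \<subseteq> T" by blast
  show "\<not> X.par (T - {i}) \<subseteq> HH i"
  proof (cases i)
    case None
    then have "stab True \<in> X.par (T - {i})" using par_hnn_without[OF L] gen_stab by simp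
    moreover have "stab True \<notin> HH i"
    proof
      assume "stab True \<in> HH i"
      then obtain a where "a \<in> par F" "stab True = base a" unfolding None HH_None by blast
      then show False using stab_not_base[of a True] by simp
    qed
    ultimately show ?thesis by blast
  next
    case (Some s)
    then have s: "s \<in> I // E" using i by (auto simp: hnn_types_def)
    \<comment> \<open>The type \<open>k\<close> occurs neither in \<open>F\<close> nor in another
      class, so it is missing from the type set of the parabolic subgroup under
      consideration.\<close>
    obtain k where k: "k \<in> s" "k \<in> I" "k \<notin> F" using class_not_subset[OF s] by blast
    have "k \<notin> support (T - {i})"
    proof
      assume "k \<in> support (T - {i})"
      then obtain s' where s': "Some s' \<in> T - {i}" "k \<in> s'" by (auto simp: support_def)
      then have "s \<noteq> s'" using Some by auto
      then have "s \<inter> s' = {}" by (rule disjoint_classes[OF s classes_of(2)[OF L s'(1)]])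
      then show False using k(1) s'(2) by blast
    qed
    then have sub: "support (T - {i}) \<union> F \<subseteq> I - {k}" using k support_subset[OF L] F_subset by blast
    have eq: "X.par (T - {i}) = base ` par (support (T - {i}) \<union> F)"
      using par_hnn_with[OF L] Some by (simp add: hnn_types_def)
    show ?thesis
    proof
      assume "X.par (T - {i}) \<subseteq> HH i"
      then have im: "base ` par (support (T - {i}) \<union> F) \<subseteq> gen (par s)"
        using eq Some by (simp only: HH_Some)
      have "par (support (T - {i}) \<union> F) \<subseteq> par s"
      proof
        fix a assume a: "a \<in> par (support (T - {i}) \<union> F)"
        then have "base a \<in> gen (par s)" using im by blast
        then show "a \<in> par s" using base_mem_gen[OF class_closed[OF s] par_carrier[OF a]] by simp
      qed
      then have "par (I - {k}) \<subseteq> H k" using par_antimono[OF sub] k(1) by (fastforce simp: parabolic_def)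
      then show False using firm_imp_not_subset[OF hel finite_I assms k(2)] by blast
    qed
  qed
qed

end

theorem theorem3p35:
  fixes A :: "('a, 'b) monoid_scheme" and I J K :: "'i set"
    and H :: "'i \<Rightarrow> 'a set" and \<phi> :: "'a \<Rightarrow> 'a"
  assumes "finite I"
    and "coset_incidence_data A I H"
    and "J \<subseteq> I" and "K \<subseteq> I"
    and "admissible A I H J K \<phi>"
    and "flag_transitive A I H"
  shows "flag_transitive (hnn_group A H J \<phi>) (hnn_types A I H J K \<phi>) (hnn_subgroup A H J K \<phi>) \<and>
    geometry
      (coset_system (hnn_group A H J \<phi>) (hnn_types A I H J K \<phi>) (hnn_subgroup A H J K \<phi>)) \<and>
    (residually_connected (coset_system A I H) \<longrightarrow> residually_connected
      (coset_system (hnn_group A H J \<phi>) (hnn_types A I H J K \<phi>) (hnn_subgroup A H J K \<phi>))) \<and>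
    (firm (coset_system A I H) \<longrightarrow> firm
      (coset_system (hnn_group A H J \<phi>) (hnn_types A I H J K \<phi>) (hnn_subgroup A H J K \<phi>)))"
proof -
  interpret coset_data A I H
    using assms(2) unfolding coset_incidence_data_def
    by (intro coset_data.intro coset_data_axioms.intro) auto
  interpret admissible_system A I H J K \<phi>
    by unfold_locales (use assms flag_transitive_imp_helly in auto)
  \<comment> \<open>\<open>p_True\<close> replaces the signed notation by \<open>par J\<close> and
    \<phi>.\<close>
  show ?thesis
    using X.helly_imp_flag_transitive[OF helly_hnn, unfolded p_True]
      X.helly_imp_geometry[OF helly_hnn, unfolded p_True]
      hnn_residually_connected[unfolded p_True] hnn_firm[unfolded p_True]
    by (intro conjI impI)
qed

end
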